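(* For each $t\in\{1,\dots,T\}$ let $S_{t-1},S_t,W_{t-1},U_{t-1},A_t$ be random variables on a common probability space, with $S_{t-1}$, $S_t$, $W_{t-1}$, $U_{t-1}$, $A_t$ categorical (finite-valued), let $A_t^{(s)}$ be the $\mathcal A$-valued potential action under the intervention $\mathrm{do}(S_t=s)$, and write $k:=|U_{t-1}|$ for the number of categories of $U_{t-1}$, $Z_t:=S_{t-1}$ (with value set $\mathcal Z$), and $\mathcal W,\mathcal A$ for the value sets of $W_{t-1},A_t$. Assume that for all $t$: 1. (Proxy conditional independences) $S_{t-1}\perp\!\!\!\perp A_t\mid (S_t,U_{t-1})$ and $(S_{t-1},S_t)\perp\!\!\!\perp W_{t-1}\mid U_{t-1}$. 2. (Consistency) For all $s$ in the support of $S_t$: $S_t=s$ implies $A_t=A_t^{(s)}$ almost surely. 3. (Positivity) $p(S_t=s\mid U_{t-1}=u)>0$ for all $u$ in the support of $U_{t-1}$ and all $s$ in the support of $S_t$. 4. (Latent exchangeability) $A_t^{(s)}\perp\!\!\!\perp S_t\mid U_{t-1}$ for all $s$. 5. (Rank condition) $|\mathcal Z|\ge k$, $|\mathcal W|\ge k$, and for every $s$ in the support of $S_t$ the matrix $P_{W\mid Z,s}$ has rank $k$; equivalently, for each such $s$ there exist coarsenings $Z'_t$ of $S_{t-1}$ and $W'_{t-1}$ of $W_{t-1}$ taking values in $\{1,\dots,k\}$ such that $P_{W'\mid Z',s}$ is square and invertible. Then the interventional action distribution is identified. In particular, for any $s$ in the support of $S_t$ and any coarsenings $(Z'_t,W'_{t-1})$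 with values in $\{1,\dots,k\}$ that make $P_{W'\mid Z',s}$ invertible, $$P\big(A_t^{(s)}\big)=P_{A\mid Z',s}\,\big(P_{W'\mid Z',s}\big)^{-1}\,P_{W'},$$ where $P(A_t^{(s)})\in\mathbb R^{|\mathcal A|}$ is the vector with entries $p(A_t^{(s)}=a)$, $a\in\mathcal A$. Consequently $\pi_{\mathrm{opt}}(s)\in\arg\max_{a\in\mathcal A}p(A_t^{(s)}=a)$ is identified for all $s$ in the support of $S_t$ (up to ties).
   Context: Interpretation: $S_t$ is an observed state, $U_t$ an unobserved latent state, $W_t$ a noisy measurement of $U_t$, $A_t$ the expert's action. The observed variables are $(S_{t-1},S_t,W_{t-1},A_t)$; a quantity is "identified" if it is determined by (is a function of) the joint distribution of the observed variables. Matrices, for fixed $s$: $P_{A\mid Z,s}\in\mathbb R^{|\mathcal A|\times|\mathcal Z|}$ has entries $p(A_t=a\mid S_{t-1}=z,S_t=s)$; $P_{W\mid Z,s}\in\mathbb R^{|\mathcal W|\times|\mathcal Z|}$ has entries $p(W_{t-1}=w\mid S_{t-1}=z,S_t=s)$; $P_W\in\mathbb R^{|\mathcal W|}$ has entries $p(W_{t-1}=w)$. The conditional probabilities written are presupposed to be well defined, i.e. the conditioning events have positive probability. A coarsening of a variable $X$ is a variable $\phi(X)$ for a (deterministic) function $\phi$. For coarsenings $Z'_t=\phi_Z(S_{t-1})$ and $W'_{t-1}=\phi_W(W_{t-1})$, the matrices $P_{A\mid Z',s}$, $P_{W'\mid Z',s}$ and vector $P_{W'}$ are defined in the same way with $Z'_t,W'_{t-1}$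 in place of $S_{t-1},W_{t-1}$: entries $p(A_t=a\mid Z'_t=z',S_t=s)$, $p(W'_{t-1}=w'\mid Z'_t=z',S_t=s)$, $p(W'_{t-1}=w')$. The policy $\pi_{\mathrm{opt}}$ is the causal imitation target, $\pi_{\mathrm{opt}}(s):=\arg\max_{a\in\mathcal A}p(A_t^{(s)}=a)$. *)

theory Defs
  imports
    "HOL-Probability.Probability"
    "Jordan_Normal_Form.DL_Rank"
    "Jordan_Normal_Form.Gauss_Jordan_Elimination"
begin

definition rv_support :: "'m measure \<Rightarrow> ('m \<Rightarrow> 'x) \<Rightarrow> 'x set" where
  "rv_support M X = {x. \<P>(\<omega> in M. X \<omega> = x) > 0}"

(* Conditional independence of discrete random variables, X independent of Y given C,
   required only at those values of C that have positive probability. *)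
definition cond_indep ::
  "'m measure \<Rightarrow> ('m \<Rightarrow> 'x) \<Rightarrow> ('m \<Rightarrow> 'y) \<Rightarrow> ('m \<Rightarrow> 'c) \<Rightarrow> bool" where
  "cond_indep M X Y C \<longleftrightarrow> (\<forall>c\<in>rv_support M C. \<forall>x y.
     \<P>(\<omega> in M. X \<omega> = x \<and> Y \<omega> = y \<bar> C \<omega> = c) =
     \<P>(\<omega> in M. X \<omega> = x \<bar> C \<omega> = c) * \<P>(\<omega> in M. Y \<omega> = y \<bar> C \<omega> = c))"

(* The matrix with entries p(X = x | Z = z, S = s), rows indexed by VX and columns by VZ.
   A finite set V is enumerated by from_nat_into V, a bijection from {..<card V} to V; the
   same enumeration is used wherever V is an index set, so matrix products and the inverse
   are taken with matching indices.  A column whose conditioning event is null is zero, so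
   an invertible matrix has only columns with conditioning events of positive probability. *)
definition cond_mat ::
  "'m measure \<Rightarrow> ('m \<Rightarrow> 'x) \<Rightarrow> 'x set \<Rightarrow> ('m \<Rightarrow> 'z) \<Rightarrow> 'z set \<Rightarrow> ('m \<Rightarrow> 's) \<Rightarrow> 's \<Rightarrow> real mat" where
  "cond_mat M X VX Z VZ S s = Matrix.mat (card VX) (card VZ) (\<lambda>(i, j).
     \<P>(\<omega> in M. X \<omega> = from_nat_into VX i \<bar> Z \<omega> = from_nat_into VZ j \<and> S \<omega> = s))"

definition prob_vec :: "'m measure \<Rightarrow> ('m \<Rightarrow> 'x) \<Rightarrow> 'x set \<Rightarrow> real Matrix.vec" where
  "prob_vec M X VX = Matrix.vec (card VX) (\<lambda>i. \<P>(\<omega> in M. X \<omega> = from_nat_into VX i))"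

definition mat_rank :: "real mat \<Rightarrow> nat" where
  "mat_rank A = vec_space.rank (dim_row A) A"

(* One time step t: Z, S, W, U, A, Apot s play the roles of
   S_{t-1}, S_t, W_{t-1}, U_{t-1}, A_t and the potential action A_t^(s);
   VZ, VS, VW, VU, VA are the corresponding value sets. *)
locale proxy_model = prob_space M
  for M :: "'m measure"
    and Z :: "'m \<Rightarrow> 'z" and S :: "'m \<Rightarrow> 's" and W :: "'m \<Rightarrow> 'w"
    and U :: "'m \<Rightarrow> 'u" and A :: "'m \<Rightarrow> 'a" and Apot :: "'s \<Rightarrow> 'm \<Rightarrow> 'a"
    and VZ :: "'z set" and VS :: "'s set" and VW :: "'w set"
    and VU :: "'u set" and VA :: "'a set" +
  assumes finite_values: "finite VZ" "finite VS" "finite VW" "finite VU" "finite VA"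
    and rv_Z: "random_variable (count_space VZ) Z"
    and rv_S: "random_variable (count_space VS) S"
    and rv_W: "random_variable (count_space VW) W"
    and rv_U: "random_variable (count_space VU) U"
    and rv_A: "random_variable (count_space VA) A"
    and rv_Apot: "\<And>s. s \<in> VS \<Longrightarrow> random_variable (count_space VA) (Apot s)"
    and well_defined:
      "\<And>z s. z \<in> VZ \<Longrightarrow> s \<in> rv_support M S \<Longrightarrow> \<P>(\<omega> in M. Z \<omega> = z \<and> S \<omega> = s) > 0"
    and action_proxy: "cond_indep M Z A (\<lambda>\<omega>. (S \<omega>, U \<omega>))"
    and measurement_proxy: "cond_indep M (\<lambda>\<omega>. (Z \<omega>, S \<omega>)) W U"
    and consistency:
      "\<And>s. s \<in> rv_support M S \<Longrightarrow> AE \<omega> in M. S \<omega> = s \<longrightarrow> A \<omega> = Apot s \<omega>"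
    and positivity:
      "\<And>u s. u \<in> rv_support M U \<Longrightarrow> s \<in> rv_support M S \<Longrightarrow> \<P>(\<omega> in M. S \<omega> = s \<bar> U \<omega> = u) > 0"
    and latent_exchangeability: "\<And>s. s \<in> VS \<Longrightarrow> cond_indep M (Apot s) S U"

definition rank_condition ::
  "'m measure \<Rightarrow> ('m \<Rightarrow> 'z) \<Rightarrow> ('m \<Rightarrow> 's) \<Rightarrow> ('m \<Rightarrow> 'w) \<Rightarrow>
   'z set \<Rightarrow> 'w set \<Rightarrow> nat \<Rightarrow> bool" where
  "rank_condition M Z S W VZ VW k \<longleftrightarrow> card VZ \<ge> k \<and> card VW \<ge> k \<and>
     (\<forall>s\<in>rv_support M S. mat_rank (cond_mat M W VW Z VZ S s) = k)"

(* The joint distribution of the observed variables. *)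
definition observed_law ::
  "'m measure \<Rightarrow> ('m \<Rightarrow> 'z) \<Rightarrow> ('m \<Rightarrow> 's) \<Rightarrow> ('m \<Rightarrow> 'w) \<Rightarrow> ('m \<Rightarrow> 'a) \<Rightarrow>
   'z set \<Rightarrow> 's set \<Rightarrow> 'w set \<Rightarrow> 'a set \<Rightarrow> ('z \<times> 's \<times> 'w \<times> 'a) measure" where
  "observed_law M Z S W A VZ VS VW VA =
     distr M (count_space (VZ \<times> VS \<times> VW \<times> VA)) (\<lambda>\<omega>. (Z \<omega>, S \<omega>, W \<omega>, A \<omega>))"

definition interv_prob :: "'m measure \<Rightarrow> ('s \<Rightarrow> 'm \<Rightarrow> 'a) \<Rightarrow> 's \<Rightarrow> 'a \<Rightarrow> real" where
  "interv_prob M Apot s a = \<P>(\<omega> in M. Apot s \<omega> = a)"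

definition argmax_actions :: "'m measure \<Rightarrow> ('s \<Rightarrow> 'm \<Rightarrow> 'a) \<Rightarrow> 'a set \<Rightarrow> 's \<Rightarrow> 'a set" where
  "argmax_actions M Apot VA s = {a. is_arg_max (interv_prob M Apot s) (\<lambda>a. a \<in> VA) a}"

(* Ties are broken by an arbitrary but fixed choice. *)
definition pi_opt :: "'m measure \<Rightarrow> ('s \<Rightarrow> 'm \<Rightarrow> 'a) \<Rightarrow> 'a set \<Rightarrow> 's \<Rightarrow> 'a" where
  "pi_opt M Apot VA s = arg_max_on (interv_prob M Apot s) VA"

end

theory Submission
  imports Defs
begin

text \<open>
  Conditioning on the latent variable factors both observed matrices through
  the same matrix: P(W' | Z', s) = B Q and P(A | Z', s) = R Q, where Q has the entries
  p(u | z', s), B the entries p(w' | u), and R the entries p(a | s, u).  Also P(W') = B P(U), and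
  consistency, positivity and latent exchangeability give P(A^(s)) = R P(U).  If B Q is
  square and invertible, then Q (B Q)^-1 B is the identity, and the formula follows.

  The equivalence of the two rank conditions rests on grouping.  The columns of a conditional
  probability matrix sum to one, so after weighting by the law of Z the sum of all
  columns is not zero.  Hence it can replace a column of some column basis, and the columns outside
  the basis can be merged into the replaced one.  The rows are treated in the same way.
\<close>

unbundle no vec_syntax

section \<open>Independent families of rows\<close>

text \<open>The obstacle in the grouping argument is cancellation: the matrix with the two rows
  \<open>1\<close> and \<open>-1\<close> has rank one, but merging them into one class leaves zero.
  So rank \<open>k\<close> alone does not yield an invertible coarsening with \<open>k\<close>
  classes; a nonzero total is what excludes this. Joint probabilities \<open>p(w, z, s)\<close>
  carry the argument because they simply add up under coarsening, whereas conditional columns would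
  have to be averaged with weights that depend on the class. Normalisation is put back at the end as
  a scaling of rows. For the converse, an invertible coarsening bounds the rank from below by
  \<open>k\<close>, and the factorization through the latent variable bounds it from above.
  Independence is that of indexed families, so equal rows at two indices are dependent and no
  enumeration is involved. In the application the first index of \<open>f\<close> runs over values
  of \<open>Z\<close>, that is, over the columns of \<open>cond_mat\<close>.\<close>

definition rows_indep :: "('i \<Rightarrow> 'j \<Rightarrow> real) \<Rightarrow> 'i set \<Rightarrow> 'j set \<Rightarrow> bool" where
  "rows_indep f I J \<longleftrightarrow>
     (\<forall>x. (\<forall>j\<in>J. (\<Sum>i\<in>I. x i * f i j) = 0) \<longrightarrow> (\<forall>i\<in>I. x i = 0))"

text \<open>Spanning is stated by explicit coefficients \<open>c\<close>, because they serve later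
  as one factor of matrix factorizations.\<close>

definition row_basis :: "('i \<Rightarrow> 'j \<Rightarrow> real) \<Rightarrow> 'i set \<Rightarrow> 'j set \<Rightarrow> 'i set \<Rightarrow> bool" where
  "row_basis f I J B \<longleftrightarrow> B \<subseteq> I \<and> rows_indep f B J \<and>
     (\<exists>c. \<forall>i\<in>I. \<forall>j\<in>J. f i j = (\<Sum>b\<in>B. c i b * f b j))"

lemma rows_indepI:
  assumes "\<And>x i. (\<And>j. j \<in> J \<Longrightarrow> (\<Sum>i\<in>I. x i * f i j) = 0) \<Longrightarrow> i \<in> I \<Longrightarrow> x i = 0"
  shows "rows_indep f I J"
  using assms unfolding rows_indep_def by blast

lemma rows_indepD:
  assumes "rows_indep f I J" "\<And>j. j \<in> J \<Longrightarrow> (\<Sum>i\<in>I. x i * f i j) = 0" "i \<in> I"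
  shows "x i = 0"
  using assms unfolding rows_indep_def by blast

lemma rows_indep_cong:
  assumes "\<And>i j. i \<in> I \<Longrightarrow> j \<in> J \<Longrightarrow> f i j = g i j"
  shows "rows_indep f I J \<longleftrightarrow> rows_indep g I J"
proof -
  have "(\<Sum>i\<in>I. x i * f i j) = (\<Sum>i\<in>I. x i * g i j)" if "j \<in> J" for x j
    using assms that by (intro sum.cong) auto
  then show ?thesis unfolding rows_indep_def by simp
qed

lemma rows_indep_reindex:
  assumes "bij_betw d I' I" "bij_betw e J' J"
  shows "rows_indep (\<lambda>i j. f (d i) (e j)) I' J' \<longleftrightarrow> rows_indep f I J"
proof
  assume L: "rows_indep (\<lambda>i j. f (d i) (e j)) I' J'"
  show "rows_indep f I J"
  proof (rule rows_indepI)
    fix x i assume x: "\<And>j. j \<in> J \<Longrightarrow> (\<Sum>i\<in>I. x i * f i j) = 0" and "i \<in> I"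
    then obtain i' where i': "i' \<in> I'" "i = d i'"
      using assms(1) unfolding bij_betw_def by auto
    have "(\<Sum>i\<in>I'. x (d i) * f (d i) (e j)) = 0" if "j \<in> J'" for j
      using x[of "e j"] that assms(2) sum.reindex_bij_betw[OF assms(1), of "\<lambda>i. x i * f i (e j)"]
      by (auto simp: bij_betw_def)
    from rows_indepD[OF L this i'(1)] show "x i = 0" using i' by simp
  qed
next
  assume R: "rows_indep f I J"
  show "rows_indep (\<lambda>i j. f (d i) (e j)) I' J'"
  proof (rule rows_indepI)
    fix x i assume x: "\<And>j. j \<in> J' \<Longrightarrow> (\<Sum>i\<in>I'. x i * f (d i) (e j)) = 0" and i: "i \<in> I'"
    let ?y = "\<lambda>i. x (inv_into I' d i)"
    have inv: "inv_into I' d (d i) = i" if "i \<in> I'" for i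
      using assms(1) that by (simp add: bij_betw_def)
    have "(\<Sum>i\<in>I. ?y i * f i j) = 0" if j: "j \<in> J" for j
    proof -
      obtain j' where j': "j' \<in> J'" "j = e j'" using assms(2) j unfolding bij_betw_def by auto
      have "(\<Sum>i\<in>I. ?y i * f i j) = (\<Sum>i\<in>I'. ?y (d i) * f (d i) j)"
        using sum.reindex_bij_betw[OF assms(1), of "\<lambda>i. ?y i * f i j"] by simp
      also have "\<dots> = (\<Sum>i\<in>I'. x i * f (d i) (e j'))"
        by (intro sum.cong) (auto simp: inv j')
      finally show ?thesis using x[OF j'(1)] by simp
    qed
    from rows_indepD[OF R this, of "d i"] show "x i = 0"
      using i inv[OF i] assms(1) by (auto simp: bij_betw_def)
  qed
qed

lemma rows_indep_scale:
  assumes "\<And>i. i \<in> I \<Longrightarrow> g i \<noteq> 0"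
  shows "rows_indep (\<lambda>i j. g i * f i j) I J \<longleftrightarrow> rows_indep f I J"
proof
  assume L: "rows_indep (\<lambda>i j. g i * f i j) I J"
  show "rows_indep f I J"
  proof (rule rows_indepI)
    fix x i assume x: "\<And>j. j \<in> J \<Longrightarrow> (\<Sum>i\<in>I. x i * f i j) = 0" and i: "i \<in> I"
    have "(\<Sum>i\<in>I. (x i / g i) * (g i * f i j)) = (\<Sum>i\<in>I. x i * f i j)" for j
      using assms by (intro sum.cong) auto
    then have "x i / g i = 0" using x i by (intro rows_indepD[OF L, of "\<lambda>i. x i / g i"]) auto
    then show "x i = 0" using assms[OF i] by simp
  qed
next
  assume R: "rows_indep f I J"
  show "rows_indep (\<lambda>i j. g i * f i j) I J"
  proof (rule rows_indepI)
    fix x i assume x: "\<And>j. j \<in> J \<Longrightarrow> (\<Sum>i\<in>I. x i * (g i * f i j)) = 0" and i: "i \<in> I"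
    have "x i * g i = 0"
      using x i by (intro rows_indepD[OF R, of "\<lambda>i. x i * g i"]) (auto simp: mult.assoc)
    then show "x i = 0" using assms[OF i] by simp
  qed
qed

text \<open>With \<open>h = g f\<close> as matrices, every left null vector of \<open>g\<close> is
  one of \<open>h\<close>. Together with \<open>rows_indep_card_le\<close> this bounds the number of
  independent rows by the inner dimension \<open>card L\<close>.\<close>

lemma rows_indep_factor:
  assumes "rows_indep h I J"
    and "\<And>i j. i \<in> I \<Longrightarrow> j \<in> J \<Longrightarrow> h i j = (\<Sum>l\<in>L. g i l * f l j)"
  shows "rows_indep g I L"
proof (rule rows_indepI)
  fix x i assume x: "\<And>l. l \<in> L \<Longrightarrow> (\<Sum>i\<in>I. x i * g i l) = 0" and i: "i \<in> I"
  have "(\<Sum>i\<in>I. x i * h i j) = 0" if "j \<in> J" for j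
  proof -
    have "(\<Sum>i\<in>I. x i * h i j) = (\<Sum>i\<in>I. \<Sum>l\<in>L. x i * g i l * f l j)"
      using that by (intro sum.cong) (auto simp: assms(2) sum_distrib_left mult.assoc)
    also have "\<dots> = (\<Sum>l\<in>L. (\<Sum>i\<in>I. x i * g i l) * f l j)"
      by (subst sum.swap) (simp add: sum_distrib_right)
    also have "\<dots> = 0" using x by simp
    finally show ?thesis .
  qed
  from rows_indepD[OF assms(1) this i] show "x i = 0" .
qed

lemma rows_indep_card_le:
  assumes "finite J" "finite I" "rows_indep f I J"
  shows "card I \<le> card J"
  using assms
proof (induction J arbitrary: f I rule: finite_induct)
  case empty
  have "I = {}"
  proof (rule ccontr)
    assume "I \<noteq> {}"
    then obtain i where "i \<in> I" by blast
    from rows_indepD[OF empty(2) _ this, of "\<lambda>_. 1"] show False by simp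
  qed
  then show ?case by simp
next
  case (insert j J)
  show ?case
  proof (cases "\<forall>i\<in>I. f i j = 0")
    case True
    have "rows_indep f I J"
    proof (rule rows_indepI)
      fix x i assume "\<And>j. j \<in> J \<Longrightarrow> (\<Sum>i\<in>I. x i * f i j) = 0" "i \<in> I"
      then show "x i = 0" using True by (intro rows_indepD[OF insert.prems(2), of x]) auto
    qed
    from insert.IH[OF insert.prems(1) this] show ?thesis using insert.hyps by simp
  next
    case False
    then obtain k where k: "k \<in> I" "f k j \<noteq> 0" by blast
    let ?g = "\<lambda>i j'. f i j' - f i j / f k j * f k j'"
    have "rows_indep ?g (I - {k}) J"
    proof (rule rows_indepI)
      fix x i assume x: "\<And>j'. j' \<in> J \<Longrightarrow> (\<Sum>i\<in>I - {k}. x i * ?g i j') = 0" and i: "i \<in> I - {k}"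
      \<comment> \<open>The coefficient at the pivot is chosen so that the original rows combine to
        the same result as the reduced rows \<open>?g\<close>. Column \<open>j\<close> then vanishes
        too, because \<open>?g i j = 0\<close>.\<close>
      let ?y = "\<lambda>i. if i = k then - (\<Sum>i\<in>I - {k}. x i * (f i j / f k j)) else x i"
      have *: "(\<Sum>i\<in>I. ?y i * f i j') = (\<Sum>i\<in>I - {k}. x i * ?g i j')" for j'
      proof -
        have "(\<Sum>i\<in>I. ?y i * f i j') = ?y k * f k j' + (\<Sum>i\<in>I - {k}. ?y i * f i j')"
          using k insert.prems by (subst sum.remove[of _ k]) auto
        also have "(\<Sum>i\<in>I - {k}. ?y i * f i j') = (\<Sum>i\<in>I - {k}. x i * f i j')"
          by (intro sum.cong) auto
        also have "?y k * f k j' = (\<Sum>i\<in>I - {k}. - (x i * (f i j / f k j) * f k j'))"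
          by (simp add: sum_distrib_right sum_negf)
        finally show ?thesis
          by (simp add: sum.distrib[symmetric] algebra_simps sum_subtractf)
      qed
      have "(\<Sum>i\<in>I. ?y i * f i j') = 0" if "j' \<in> insert j J" for j'
        using that x k by (cases "j' = j") (simp_all only: *, auto)
      from rows_indepD[OF insert.prems(2) this, of i] show "x i = 0" using i by auto
    qed
    from insert.IH[OF _ this] have "card (I - {k}) \<le> card J" using insert.prems by simp
    then show ?thesis using insert.hyps k insert.prems by (simp add: card_Diff_singleton)
  qed
qed

text \<open>Greedy choice: a new row joins the basis unless it is a combination of the rows chosen
  so far.\<close>

lemma row_basis_exists:
  assumes "finite I"
  shows "\<exists>B. row_basis f I J B"
  using assms
proof (induction I rule: finite_induct)
  case empty
  then show ?case by (auto simp: row_basis_def rows_indep_def)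
next
  case (insert k I)
  then obtain B c where B: "B \<subseteq> I" "rows_indep f B J"
    and c: "\<And>i j. i \<in> I \<Longrightarrow> j \<in> J \<Longrightarrow> f i j = (\<Sum>b\<in>B. c i b * f b j)"
    unfolding row_basis_def by blast
  have fin: "finite B" and kB: "k \<notin> B" using B insert.hyps finite_subset by auto
  show ?case
  proof (cases "\<exists>d. \<forall>j\<in>J. f k j = (\<Sum>b\<in>B. d b * f b j)")
    case True
    then obtain d where d: "\<forall>j\<in>J. f k j = (\<Sum>b\<in>B. d b * f b j)" by blast
    have "row_basis f (insert k I) J B"
      unfolding row_basis_def using B c d insert.hyps
      by (auto intro!: exI[of _ "\<lambda>i. if i = k then d else c i"])
    then show ?thesis by blast
  next
    case False
    have "rows_indep f (insert k B) J"
    proof (rule rows_indepI)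
      fix x i assume x: "\<And>j. j \<in> J \<Longrightarrow> (\<Sum>i\<in>insert k B. x i * f i j) = 0" and i: "i \<in> insert k B"
      have x': "x k * f k j + (\<Sum>b\<in>B. x b * f b j) = 0" if "j \<in> J" for j
        using x[OF that] fin kB by simp
      have xk: "x k = 0"
      proof (rule ccontr)
        assume nz: "x k \<noteq> 0"
        have "f k j = (\<Sum>b\<in>B. (- x b / x k) * f b j)" if "j \<in> J" for j
        proof -
          have "(\<Sum>b\<in>B. (- x b / x k) * f b j) = - (\<Sum>b\<in>B. x b * f b j) / x k"
            by (simp add: sum_negf sum_divide_distrib)
          moreover have "f k j = - (\<Sum>b\<in>B. x b * f b j) / x k"
            using x'[OF that] nz nonzero_mult_div_cancel_left[of "x k" "f k j"]
            by (metis add.commute add_eq_0_iff)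
          ultimately show ?thesis by simp
        qed
        then show False using False by (auto dest!: spec[of _ "\<lambda>b. - x b / x k"])
      qed
      then show "x i = 0" using i x' rows_indepD[OF B(2), of x i] by auto
    qed
    moreover have "\<exists>c. \<forall>i\<in>insert k I. \<forall>j\<in>J. f i j = (\<Sum>b\<in>insert k B. c i b * f b j)"
    proof (intro exI ballI)
      fix i j assume "i \<in> insert k I" "j \<in> J"
      moreover have "(\<Sum>b\<in>B. (if b = k then 1 else 0) * f b j) = 0"
        using kB by (intro sum.neutral) auto
      moreover have "(\<Sum>b\<in>B. (if b = k then 0 else c i b) * f b j) = (\<Sum>b\<in>B. c i b * f b j)"
        using kB by (intro sum.cong) auto
      ultimately show "f i j = (\<Sum>b\<in>insert k B.
          (if i = k then if b = k then 1 else 0 else if b = k then 0 else c i b) * f b j)"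
        using c fin kB by auto
    qed
    ultimately have "row_basis f (insert k I) J (insert k B)"
      using B unfolding row_basis_def by auto
    then show ?thesis by blast
  qed
qed

text \<open>The coefficients \<open>c\<close> recover each column from its entries at
  \<open>B\<close>, so independent columns stay independent when cut down to \<open>B\<close>.
  Counting rows and then columns gives both inequalities.\<close>

lemma row_basis_card_eq:
  assumes "finite I" "finite J" "row_basis f I J B" "rows_indep (\<lambda>j i. f i j) J I"
  shows "card B = card J"
proof (rule antisym)
  have fin: "finite B" and B: "rows_indep f B J" using assms finite_subset unfolding row_basis_def by auto
  show "card B \<le> card J" using rows_indep_card_le[OF assms(2) fin B] .
  obtain c where c: "\<forall>i\<in>I. \<forall>j\<in>J. f i j = (\<Sum>b\<in>B. c i b * f b j)"
    using assms(3) unfolding row_basis_def by blast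
  have "rows_indep (\<lambda>j i. f i j) J B"
    by (rule rows_indep_factor[OF assms(4), where f = "\<lambda>b i. c i b"])
      (use c in \<open>auto simp: mult.commute\<close>)
  from rows_indep_card_le[OF fin assms(2) this] show "card J \<le> card B" .
qed

section \<open>Merging rows and columns without losing independence\<close>

text \<open>If the total row does not vanish, it can replace some basis row.  The replaced row
  collects all rows outside the basis, and the remaining basis rows stay alone.\<close>
lemma row_grouping_basis:
  assumes "finite I" "row_basis f I J B" "j0 \<in> J" "(\<Sum>i\<in>I. f i j0) \<noteq> 0"
  shows "\<exists>g\<in>I \<rightarrow> B. rows_indep (\<lambda>b j. \<Sum>i\<in>{i\<in>I. g i = b}. f i j) B J"
proof -
  obtain c where BI: "B \<subseteq> I" and B: "rows_indep f B J"
    and c: "\<And>i j. i \<in> I \<Longrightarrow> j \<in> J \<Longrightarrow> f i j = (\<Sum>b\<in>B. c i b * f b j)"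
    using assms(2) unfolding row_basis_def by blast
  have fin: "finite B" using BI assms(1) finite_subset by auto
  \<comment> \<open>Coordinates of the total row in the basis. Since this row is nonzero at
    \<open>j0\<close>, some \<open>r k\<close> is nonzero, and row \<open>k\<close> is the one to be
    replaced.\<close>
  define r where "r b = (\<Sum>i\<in>I. c i b)" for b
  have r: "(\<Sum>i\<in>I. f i j) = (\<Sum>b\<in>B. r b * f b j)" if "j \<in> J" for j
  proof -
    have "(\<Sum>i\<in>I. f i j) = (\<Sum>i\<in>I. \<Sum>b\<in>B. c i b * f b j)"
      using c that by (intro sum.cong) auto
    also have "\<dots> = (\<Sum>b\<in>B. r b * f b j)"
      by (subst sum.swap) (simp add: r_def sum_distrib_right)
    finally show ?thesis .
  qed
  obtain k where k: "k \<in> B" "r k \<noteq> 0"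
    using assms(4) r[OF assms(3)] by (metis (no_types, lifting) mult_zero_left sum.neutral)
  define g where "g i = (if i \<in> B then i else k)" for i
  let ?h = "\<lambda>b j. \<Sum>i\<in>{i\<in>I. g i = b}. f i j"
  have h1: "?h b j = f b j" if "b \<in> B - {k}" for b j
  proof -
    have "{i\<in>I. g i = b} = {b}" using that BI by (auto simp: g_def split: if_splits)
    then show ?thesis by simp
  qed
  have g: "g \<in> I \<rightarrow> B" using k by (auto simp: g_def)
  have tot: "(\<Sum>b\<in>B. ?h b j) = (\<Sum>i\<in>I. f i j)" for j
    using sum.group[of I B g "\<lambda>i. f i j"] assms(1) fin g by (auto simp: Pi_iff image_subset_iff)
  have hk: "?h k j = (\<Sum>b\<in>B. r b * f b j) - (\<Sum>b\<in>B - {k}. f b j)" if "j \<in> J" for j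
  proof -
    have "(\<Sum>b\<in>B. ?h b j) = ?h k j + (\<Sum>b\<in>B - {k}. ?h b j)"
      using k fin by (subst sum.remove[of _ k]) auto
    also have "(\<Sum>b\<in>B - {k}. ?h b j) = (\<Sum>b\<in>B - {k}. f b j)"
      using h1 by (intro sum.cong) auto
    finally show ?thesis using tot[of j] r[OF that] by simp
  qed
  have "rows_indep ?h B J"
  proof (rule rows_indepI)
    fix x i assume x: "\<And>j. j \<in> J \<Longrightarrow> (\<Sum>b\<in>B. x b * ?h b j) = 0" and i: "i \<in> B"
    \<comment> \<open>Writing \<open>?h k\<close> as the total row minus the other basis rows turns
      a combination of merged rows into one of basis rows. At \<open>k\<close> only
      \<open>x k * r k\<close> remains, which forces \<open>x k = 0\<close>; then
      \<open>?y i\<close> is just \<open>x i\<close> elsewhere.\<close>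
    let ?y = "\<lambda>b. x k * r b + (if b = k then 0 else x b - x k)"
    have y: "(\<Sum>b\<in>B. ?y b * f b j) = 0" if j: "j \<in> J" for j
    proof -
      have "0 = x k * ?h k j + (\<Sum>b\<in>B - {k}. x b * ?h b j)"
        using x[OF j] k fin by (subst (asm) sum.remove[of _ k]) auto
      also have "(\<Sum>b\<in>B - {k}. x b * ?h b j) = (\<Sum>b\<in>B - {k}. x b * f b j)"
        using h1 by (intro sum.cong) auto
      also have "x k * ?h k j = (\<Sum>b\<in>B. x k * r b * f b j) - (\<Sum>b\<in>B - {k}. x k * f b j)"
        using hk[OF j] by (simp add: right_diff_distrib sum_distrib_left mult.assoc)
      finally have "0 = (\<Sum>b\<in>B. x k * r b * f b j) + (\<Sum>b\<in>B - {k}. (x b - x k) * f b j)"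
        by (simp add: left_diff_distrib sum_subtractf)
      also have "(\<Sum>b\<in>B - {k}. (x b - x k) * f b j)
          = (\<Sum>b\<in>B. (if b = k then 0 else x b - x k) * f b j)"
        using k fin by (subst (2) sum.remove[of _ k]) (auto intro!: sum.cong)
      finally show ?thesis unfolding distrib_right sum.distrib by (rule sym)
    qed
    have "?y k = 0" by (rule rows_indepD[OF B y k(1)])
    then have "x k = 0" using k by simp
    moreover have "?y i = 0" by (rule rows_indepD[OF B y i])
    ultimately show "x i = 0" by (auto split: if_splits)
  qed
  then show ?thesis using g by blast
qed

text \<open>Renames the classes from basis elements to labels in \<open>K\<close>, so that row and
  column coarsenings can share one label set.\<close>

lemma row_grouping:
  assumes "finite I" "row_basis f I J B" "j0 \<in> J" "(\<Sum>i\<in>I. f i j0) \<noteq> 0"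
    and "finite K" "card K = card B"
  shows "\<exists>\<phi>\<in>I \<rightarrow> K. rows_indep (\<lambda>k j. \<Sum>i\<in>{i\<in>I. \<phi> i = k}. f i j) K J"
proof -
  obtain g where g: "g \<in> I \<rightarrow> B" and ind: "rows_indep (\<lambda>b j. \<Sum>i\<in>{i\<in>I. g i = b}. f i j) B J"
    using row_grouping_basis[OF assms(1-4)] by blast
  have "finite B" using assms(1,2) finite_subset unfolding row_basis_def by auto
  then obtain e where e: "bij_betw e B K"
    using assms(5,6) finite_same_card_bij by metis
  let ?\<phi> = "\<lambda>i. e (g i)"
  have id: "bij_betw id J J" by simp
  have "rows_indep (\<lambda>b j. (\<lambda>k j. \<Sum>i\<in>{i\<in>I. ?\<phi> i = k}. f i j) (e b) (id j)) B J
      \<longleftrightarrow> rows_indep (\<lambda>b j. \<Sum>i\<in>{i\<in>I. g i = b}. f i j) B J"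
  proof (rule rows_indep_cong)
    fix b j assume b: "b \<in> B"
    have "{i\<in>I. ?\<phi> i = e b} = {i\<in>I. g i = b}"
      using e b g unfolding bij_betw_def inj_on_def by (auto simp: Pi_iff)
    then show "(\<Sum>i\<in>{i\<in>I. ?\<phi> i = e b}. f i (id j)) = (\<Sum>i\<in>{i\<in>I. g i = b}. f i j)" by simp
  qed
  then have "rows_indep (\<lambda>k j. \<Sum>i\<in>{i\<in>I. ?\<phi> i = k}. f i j) K J"
    using ind rows_indep_reindex[OF e id, of "\<lambda>k j. \<Sum>i\<in>{i\<in>I. ?\<phi> i = k}. f i j"] by blast
  moreover have "?\<phi> \<in> I \<rightarrow> K" using g e by (auto simp: bij_betw_def Pi_iff)
  ultimately show ?thesis by (intro bexI[of _ ?\<phi>])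
qed

lemma rows_indep_nonzero_row:
  assumes "finite I" "rows_indep f I J" "i \<in> I"
  shows "\<exists>j\<in>J. f i j \<noteq> 0"
proof (rule ccontr)
  assume "\<not> (\<exists>j\<in>J. f i j \<noteq> 0)"
  then have "(\<Sum>l\<in>I. (if l = i then 1 else 0) * f l j) = 0" if "j \<in> J" for j
    using that assms(1) by (intro sum.neutral) auto
  from rows_indepD[OF assms(2) this assms(3)] show False by simp
qed

text \<open>\<open>p i\<close> will be the probability of a conditioning event, which can be null
  for a coarse value. Then row \<open>i\<close> is zero on both sides and neither family is
  independent; otherwise the rows are merely scaled.\<close>

lemma rows_indep_divide:
  assumes "finite I" "\<And>i j. i \<in> I \<Longrightarrow> j \<in> J \<Longrightarrow> p i = 0 \<Longrightarrow> f i j = 0"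
  shows "rows_indep (\<lambda>i j. f i j / p i) I J \<longleftrightarrow> rows_indep f I J"
proof (cases "\<exists>i\<in>I. p i = 0")
  case True
  then obtain i where i: "i \<in> I" "p i = 0" by blast
  then show ?thesis
    using rows_indep_nonzero_row[OF assms(1) _ i(1), where J = J] assms(2) by fastforce
next
  case False
  then show ?thesis using rows_indep_scale[of I "\<lambda>i. 1 / p i" f J] by simp
qed

text \<open>Dividing rows only rescales the coefficients \<open>c\<close>, so the rank of a
  conditional matrix can be computed from joint probabilities.\<close>

lemma row_basis_divide:
  assumes "row_basis f I J B" "\<And>i. i \<in> I \<Longrightarrow> p i \<noteq> 0"
  shows "row_basis (\<lambda>i j. f i j / p i) I J B"
proof -
  obtain c where BI: "B \<subseteq> I" and B: "rows_indep f B J"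
    and c: "\<And>i j. i \<in> I \<Longrightarrow> j \<in> J \<Longrightarrow> f i j = (\<Sum>b\<in>B. c i b * f b j)"
    using assms(1) unfolding row_basis_def by blast
  have "rows_indep (\<lambda>i j. f i j / p i) B J"
    using rows_indep_scale[of B "\<lambda>i. 1 / p i" f J] B BI assms(2) by auto
  moreover have "f i j / p i = (\<Sum>b\<in>B. (c i b * p b / p i) * (f b j / p b))" if "i \<in> I" "j \<in> J" for i j
  proof -
    have "(\<Sum>b\<in>B. (c i b * p b / p i) * (f b j / p b)) = (\<Sum>b\<in>B. c i b * f b j / p i)"
      using BI assms(2) by (intro sum.cong) auto
    then show ?thesis using c[OF that] by (simp add: sum_divide_distrib)
  qed
  ultimately show ?thesis
    unfolding row_basis_def using BI by (auto intro!: exI[of _ "\<lambda>i b. c i b * p b / p i"])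
qed

text \<open>A row basis has as many elements as there are independent columns, here
  \<open>card I\<close>, so it is all of \<open>I\<close>.\<close>

lemma rows_indep_transpose:
  assumes "finite I" "finite J" "card I = card J" "rows_indep (\<lambda>j i. f i j) J I"
  shows "rows_indep f I J"
proof -
  obtain B where B: "row_basis f I J B" using row_basis_exists[OF assms(1)] by blast
  have "card B = card I" using row_basis_card_eq[OF assms(1,2) B assms(4)] assms(3) by simp
  moreover have "B \<subseteq> I" using B by (simp add: row_basis_def)
  ultimately have "B = I" using assms(1) by (simp add: card_subset_eq)
  then show ?thesis using B by (simp add: row_basis_def)
qed

text \<open>Rows are merged first, then the columns of the result. The nonzero total is available
  both times, because merging rows preserves the sum of all entries.\<close>

lemma row_column_grouping:
  assumes fin: "finite I" "finite J" "finite K"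
    and B: "row_basis f I J B" "card B = card K"
    and total: "(\<Sum>i\<in>I. \<Sum>j\<in>J. f i j) \<noteq> 0"
  shows "\<exists>\<phi>\<in>I \<rightarrow> K. \<exists>\<psi>\<in>J \<rightarrow> K.
    rows_indep (\<lambda>k l. \<Sum>i\<in>{i\<in>I. \<phi> i = k}. \<Sum>j\<in>{j\<in>J. \<psi> j = l}. f i j) K K"
proof -
  have "(\<Sum>j\<in>J. \<Sum>i\<in>I. f i j) \<noteq> 0" using total by (subst sum.swap)
  then obtain j0 where "j0 \<in> J" "(\<Sum>i\<in>I. f i j0) \<noteq> 0" by (meson sum.neutral)
  from row_grouping[OF fin(1) B(1) this fin(3)] B(2) obtain \<phi> where \<phi>: "\<phi> \<in> I \<rightarrow> K"
    and ind: "rows_indep (\<lambda>k j. \<Sum>i\<in>{i\<in>I. \<phi> i = k}. f i j) K J" by auto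
  let ?g = "\<lambda>j k. \<Sum>i\<in>{i\<in>I. \<phi> i = k}. f i j"
  obtain B' where B': "row_basis ?g J K B'" using row_basis_exists[OF fin(2)] by blast
  \<comment> \<open>The merged rows are independent, so a column basis of the merged family has
    exactly \<open>card K\<close> elements.\<close>
  have card: "card K = card B'" using row_basis_card_eq[OF fin(2,3) B' ind] by simp
  have "(\<Sum>k\<in>K. \<Sum>j\<in>J. ?g j k) = (\<Sum>k\<in>K. \<Sum>i\<in>{i\<in>I. \<phi> i = k}. \<Sum>j\<in>J. f i j)"
    by (intro sum.cong refl sum.swap)
  also have "\<dots> = (\<Sum>i\<in>I. \<Sum>j\<in>J. f i j)"
    using \<phi> fin by (intro sum.group) auto
  finally have "(\<Sum>k\<in>K. \<Sum>j\<in>J. ?g j k) \<noteq> 0" using total by simp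
  then obtain k0 where "k0 \<in> K" "(\<Sum>j\<in>J. ?g j k0) \<noteq> 0" by (meson sum.neutral)
  from row_grouping[OF fin(2) B' this fin(3) card] obtain \<psi> where \<psi>: "\<psi> \<in> J \<rightarrow> K"
    and ind': "rows_indep (\<lambda>l k. \<Sum>j\<in>{j\<in>J. \<psi> j = l}. ?g j k) K K" by auto
  have "rows_indep (\<lambda>k l. \<Sum>j\<in>{j\<in>J. \<psi> j = l}. ?g j k) K K"
    by (rule rows_indep_transpose[OF fin(3,3) refl ind'])
  moreover have "(\<Sum>j\<in>{j\<in>J. \<psi> j = l}. ?g j k) =
      (\<Sum>i\<in>{i\<in>I. \<phi> i = k}. \<Sum>j\<in>{j\<in>J. \<psi> j = l}. f i j)" for k l
    by (rule sum.swap)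
  ultimately show ?thesis using \<phi> \<psi> by auto
qed

section \<open>Invertibility and rank of matrices\<close>

lemma invertible_mat_iff_det:
  fixes A :: "'a::field mat"
  assumes "A \<in> carrier_mat n n"
  shows "invertible_mat A \<longleftrightarrow> Determinant.det A \<noteq> 0"
proof
  assume "invertible_mat A"
  then obtain B where B: "A * B = 1\<^sub>m n" "B * A = 1\<^sub>m (dim_row B)"
    using assms unfolding invertible_mat_def inverts_mat_def by auto
  \<comment> \<open>\<open>inverts_mat\<close> leaves the dimensions of \<open>B\<close> open;
    comparing column counts in the two products fixes them.\<close>
  have "dim_col B = n" using arg_cong[OF B(1), of dim_col] by simp
  moreover have "dim_row B = n" using arg_cong[OF B(2), of dim_col] assms by simp
  ultimately have "B \<in> carrier_mat n n" by auto
  then have "Determinant.det A * Determinant.det B = 1" using det_mult[OF assms, of B] B(1) by simp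
  then show "Determinant.det A \<noteq> 0" by auto
next
  assume "Determinant.det A \<noteq> 0"
  from det_non_zero_imp_unit[OF assms this] show "invertible_mat A"
    using assms unfolding invertible_mat_def inverts_mat_def Units_def ring_mat_def by auto
qed

text \<open>\<open>A *\<^sub>v v\<close> is the combination of the columns with coefficients
  \<open>v\<close>, and the determinant vanishes iff some nonzero \<open>v\<close> is sent to
  zero.\<close>

lemma invertible_mat_iff_cols_indep:
  fixes A :: "real mat"
  assumes A: "A \<in> carrier_mat n n"
  shows "invertible_mat A \<longleftrightarrow> rows_indep (\<lambda>j i. A $$ (i, j)) {..<n} {..<n}"
proof -
  have index: "(A *\<^sub>v v) $ i = (\<Sum>j<n. v $ j * A $$ (i, j))" if "v \<in> carrier_vec n" "i < n" for v i
    using A that by (auto simp: scalar_prod_def atLeast0LessThan mult.commute intro!: sum.cong)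
  have "rows_indep (\<lambda>j i. A $$ (i, j)) {..<n} {..<n} \<longleftrightarrow>
      (\<forall>v\<in>carrier_vec n. A *\<^sub>v v = 0\<^sub>v n \<longrightarrow> v = 0\<^sub>v n)"
  proof
    assume L: "rows_indep (\<lambda>j i. A $$ (i, j)) {..<n} {..<n}"
    show "\<forall>v\<in>carrier_vec n. A *\<^sub>v v = 0\<^sub>v n \<longrightarrow> v = 0\<^sub>v n"
    proof (intro ballI impI)
      fix v :: "real Matrix.vec" assume v: "v \<in> carrier_vec n" "A *\<^sub>v v = 0\<^sub>v n"
      have "v $ i = 0" if "i < n" for i
        using that v index[OF v(1)] by (intro rows_indepD[OF L, of "\<lambda>j. v $ j"]) auto
      then show "v = 0\<^sub>v n" using v by (intro eq_vecI) auto
    qed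
  next
    assume R: "\<forall>v\<in>carrier_vec n. A *\<^sub>v v = 0\<^sub>v n \<longrightarrow> v = 0\<^sub>v n"
    show "rows_indep (\<lambda>j i. A $$ (i, j)) {..<n} {..<n}"
    proof (rule rows_indepI)
      fix x i assume x: "\<And>i. i \<in> {..<n} \<Longrightarrow> (\<Sum>j<n. x j * A $$ (i, j)) = 0" and i: "i \<in> {..<n}"
      let ?v = "Matrix.vec n x"
      have "A *\<^sub>v ?v = 0\<^sub>v n"
        using A x by (intro eq_vecI) (auto simp: index simp del: index_mult_mat_vec)
      then have "?v = 0\<^sub>v n" using R by auto
      then have "?v $ i = 0" using i by auto
      then show "x i = 0" using i by auto
    qed
  qed
  then show ?thesis
    using invertible_mat_iff_det[OF A] det_0_iff_vec_prod_zero_field[OF A] by blast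
qed

text \<open>The labels \<open>V'\<close> of the matrix columns come first in \<open>f\<close>, so
  \<open>rows_indep\<close> sees the columns. Enumerations disappear here, and later arguments work
  with label sets.\<close>

lemma invertible_mat_enum_iff:
  assumes "finite V" "finite V'" "card V' = card V"
  shows "invertible_mat (Matrix.mat (card V) (card V')
      (\<lambda>(i, j). f (from_nat_into V' j) (from_nat_into V i))) \<longleftrightarrow> rows_indep f V' V"
proof -
  let ?A = "Matrix.mat (card V) (card V') (\<lambda>(i, j). f (from_nat_into V' j) (from_nat_into V i))"
  have A: "?A \<in> carrier_mat (card V) (card V)" using assms by auto
  have "rows_indep (\<lambda>j i. ?A $$ (i, j)) {..<card V} {..<card V} \<longleftrightarrow>
      rows_indep (\<lambda>j i. f (from_nat_into V' j) (from_nat_into V i)) {..<card V'} {..<card V}"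
    using assms by (subst rows_indep_cong) auto
  also have "\<dots> \<longleftrightarrow> rows_indep f V' V"
    using assms by (intro rows_indep_reindex bij_betw_from_nat_into_finite)
  finally show ?thesis using invertible_mat_iff_cols_indep[OF A] by simp
qed

lemma (in vec_space) lin_dep_finite_iff:
  assumes "finite X" "X \<subseteq> carrier_vec n"
  shows "lin_dep X \<longleftrightarrow> (\<exists>a. (\<exists>x\<in>X. a x \<noteq> 0) \<and> (\<forall>i<n. (\<Sum>x\<in>X. a x * x $ i) = 0))"
proof
  assume "lin_dep X"
  then obtain a v where "lincomb a X = 0\<^sub>v n" "v \<in> X" "a v \<noteq> 0"
    using finite_lin_dep[OF assms(1)] assms(2) by (auto simp: module_vec_simps)
  then show "\<exists>a. (\<exists>x\<in>X. a x \<noteq> 0) \<and> (\<forall>i<n. (\<Sum>x\<in>X. a x * x $ i) = 0)"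
    using lincomb_index[OF _ assms(2), where a = a] by (intro exI[of _ a]) auto
next
  assume "\<exists>a. (\<exists>x\<in>X. a x \<noteq> 0) \<and> (\<forall>i<n. (\<Sum>x\<in>X. a x * x $ i) = 0)"
  then obtain a v where a: "v \<in> X" "a v \<noteq> 0" "\<forall>i<n. (\<Sum>x\<in>X. a x * x $ i) = 0" by blast
  have "lincomb a X = 0\<^sub>v n"
    using a lincomb_index[OF _ assms(2), where a = a] lincomb_dim[OF assms, of a] by (intro eq_vecI) auto
  then show "lin_dep X"
    using a assms by (intro lin_dep_crit[where A = X and S = X and a = a and v = v]) (auto simp: module_vec_simps class_ring_simps)
qed

text \<open>\<open>rank_card_indpt\<close> reads the rank off a maximal independent subset of the
  set of columns. The columns with labels in \<open>B\<close> form one; since equal columns collapse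
  in a set, \<open>r\<close> must be injective on \<open>B\<close> for the count.\<close>

lemma mat_rank_enum:
  assumes "finite V" "finite V'" "row_basis f V' V B"
  shows "mat_rank (Matrix.mat (card V) (card V')
      (\<lambda>(i, j). f (from_nat_into V' j) (from_nat_into V i))) = card B"
proof -
  let ?n = "card V"
  let ?A = "Matrix.mat ?n (card V') (\<lambda>(i, j). f (from_nat_into V' j) (from_nat_into V i))"
  interpret vec_space "TYPE(real)" ?n .
  define r where "r z = Matrix.vec ?n (\<lambda>i. f z (from_nat_into V i))" for z
  obtain c where BV: "B \<subseteq> V'" and B: "rows_indep f B V"
    and c: "\<And>i j. i \<in> V' \<Longrightarrow> j \<in> V \<Longrightarrow> f i j = (\<Sum>b\<in>B. c i b * f b j)"
    using assms(3) unfolding row_basis_def by blast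
  have bij: "bij_betw (from_nat_into V) {..<?n} V" "bij_betw (from_nat_into V') {..<card V'} V'"
    using assms by (auto intro: bij_betw_from_nat_into_finite)
  have "set (cols ?A) = (\<lambda>j. r (from_nat_into V' j)) ` {..<card V'}"
    unfolding cols_def r_def by (auto intro!: image_eqI simp: Matrix.col_def)
  also have "\<dots> = r ` V'" using bij(2) unfolding bij_betw_def by (metis image_image)
  finally have cols: "set (cols ?A) = r ` V'" .
  have fin: "finite B" using BV assms finite_subset by auto
  have car: "r ` X \<subseteq> carrier_vec ?n" for X by (auto simp: r_def)
  have zero_iff: "(\<forall>i<?n. (\<Sum>z\<in>X. a z * r z $ i) = 0) \<longleftrightarrow> (\<forall>v\<in>V. (\<Sum>z\<in>X. a z * f z v) = 0)" for X a
  proof -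
    have "(\<forall>v\<in>from_nat_into V ` {..<?n}. (\<Sum>z\<in>X. a z * f z v) = 0) \<longleftrightarrow>
        (\<forall>i<?n. (\<Sum>z\<in>X. a z * f z (from_nat_into V i)) = 0)" by auto
    from this[unfolded bij_betw_imp_surj_on[OF bij(1)]] show ?thesis by (simp add: r_def)
  qed
  have inj: "inj_on r B"
  proof (rule inj_onI, rule ccontr)
    fix y z assume yz: "y \<in> B" "z \<in> B" "r y = r z" "y \<noteq> z"
    let ?a = "\<lambda>b. if b = y then 1 else if b = z then -1 else (0::real)"
    have "(\<Sum>b\<in>B. ?a b * r b $ i) = 0" for i
    proof -
      have "(\<Sum>b\<in>B. ?a b * r b $ i) = (\<Sum>b\<in>{y, z}. ?a b * r b $ i)"
        using yz fin by (intro sum.mono_neutral_right) auto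
      also have "\<dots> = r y $ i - r z $ i" using yz(4) by simp
      finally show ?thesis unfolding yz(3) by simp
    qed
    then have "\<forall>i<?n. (\<Sum>b\<in>B. ?a b * r b $ i) = 0" by simp
    then have "\<forall>v\<in>V. (\<Sum>b\<in>B. ?a b * f b v) = 0" by (rule iffD1[OF zero_iff])
    then have "?a y = 0" by (intro rows_indepD[OF B _ yz(1), of ?a]) (rule bspec)
    then show False by simp
  qed
  have indep: "lin_indpt (r ` B)"
  proof
    assume "lin_dep (r ` B)"
    then obtain a b where ab: "b \<in> B" "a (r b) \<noteq> 0"
      and "\<forall>i<?n. (\<Sum>x\<in>r ` B. a x * x $ i) = 0"
      using lin_dep_finite_iff[of "r ` B"] fin car by auto
    then have "\<forall>i<?n. (\<Sum>z\<in>B. a (r z) * r z $ i) = 0" using inj by (simp add: sum.reindex)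
    then have "\<forall>v\<in>V. (\<Sum>z\<in>B. a (r z) * f z v) = 0"
      by (rule iffD1[OF zero_iff])
    then have "a (r b) = 0" by (intro rows_indepD[OF B _ ab(1), of "\<lambda>z. a (r z)"]) (rule bspec)
    then show False using ab by simp
  qed
  have "maximal (r ` B) (\<lambda>T. T \<subseteq> set (cols ?A) \<and> lin_indpt T)"
    unfolding maximal_def
  proof (intro conjI allI impI)
    show "r ` B \<subseteq> set (cols ?A)" using BV cols by auto
    show "lin_indpt (r ` B)" by (rule indep)
    fix T assume T: "r ` B \<subseteq> T \<and> T \<subseteq> set (cols ?A) \<and> lin_indpt T"
    show "T = r ` B"
    proof (rule ccontr)
      assume "T \<noteq> r ` B"
      then obtain t where t: "t \<in> T" "t \<notin> r ` B" using T by auto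
      then obtain z where z: "z \<in> V'" "t = r z" using T cols by auto
      let ?X = "insert t (r ` B)"
      \<comment> \<open>The relation expressing column \<open>z\<close> by the basis;
        \<open>inv_into\<close> recovers the label from a basis vector.\<close>
      let ?a = "\<lambda>x. if x = t then - 1 else c z (inv_into B r x)"
      have "(\<Sum>x\<in>?X. ?a x * x $ i) = 0" if i: "i < ?n" for i
      proof -
        have "(\<Sum>x\<in>?X. ?a x * x $ i) = - (r z $ i) + (\<Sum>x\<in>r ` B. ?a x * x $ i)"
          using t z fin by simp
        also have "(\<Sum>x\<in>r ` B. ?a x * x $ i) = (\<Sum>b\<in>B. c z b * r b $ i)"
          using inj t by (auto simp: sum.reindex intro!: sum.cong)
        also have "\<dots> = r z $ i"
        proof -
          have "from_nat_into V i \<in> V" using bij(1) i by (auto simp: bij_betw_def)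
          then show ?thesis using i c[OF z(1)] by (simp add: r_def)
        qed
        finally show ?thesis by simp
      qed
      then have "\<exists>a. (\<exists>x\<in>?X. a x \<noteq> 0) \<and> (\<forall>i<?n. (\<Sum>x\<in>?X. a x * x $ i) = 0)"
        by (intro exI[of _ ?a]) auto
      moreover have "?X \<subseteq> carrier_vec ?n" using car z by (auto simp: r_def)
      ultimately have "lin_dep ?X" using fin by (subst lin_dep_finite_iff) auto
      then show False using T t subset_li_is_li[of T ?X] by auto
    qed
  qed
  from rank_card_indpt[OF mat_carrier this] have "rank ?A = card (r ` B)" .
  then show ?thesis using card_image[OF inj] by (simp add: mat_rank_def)
qed

lemma mat_inverse_the:
  fixes P :: "'a::field mat"
  assumes "P \<in> carrier_mat n n" "invertible_mat P"
  shows "the (mat_inverse P) \<in> carrier_mat n n" "P * the (mat_inverse P) = 1\<^sub>m n"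
proof -
  have "Determinant.det P \<noteq> 0" using invertible_mat_iff_det assms by blast
  from det_non_zero_imp_unit[OF assms(1) this, of "()"] obtain Q where "mat_inverse P = Some Q"
    using mat_inverse(1)[OF assms(1), of "()"] by fastforce
  then show "the (mat_inverse P) \<in> carrier_mat n n" "P * the (mat_inverse P) = 1\<^sub>m n"
    using mat_inverse(2)[OF assms(1)] by auto
qed

lemma factored_inverse_cancel:
  fixes B Q R :: "'a::field mat"
  assumes carrier: "B \<in> carrier_mat n n" "Q \<in> carrier_mat n n" "R \<in> carrier_mat m n" "p \<in> carrier_vec n"
    and inv: "invertible_mat (B * Q)"
  shows "(R * Q * the (mat_inverse (B * Q))) *\<^sub>v (B *\<^sub>v p) = R *\<^sub>v p"
proof -
  let ?I = "the (mat_inverse (B * Q))"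
  have BQ: "B * Q \<in> carrier_mat n n" using carrier by auto
  note I = mat_inverse_the[OF BQ inv]
  have "B * (Q * ?I) = 1\<^sub>m n" using I carrier assoc_mult_mat[of B n n Q n ?I n] by simp
  \<comment> \<open>\<open>Q * ?I\<close> is a right inverse of the square matrix \<open>B\<close>,
    hence also a left inverse.\<close>
  then have cancel: "(Q * ?I) * B = 1\<^sub>m n"
    using mat_mult_left_right_inverse[of B n "Q * ?I"] carrier I by auto
  have "(R * Q * ?I) *\<^sub>v (B *\<^sub>v p) = (R * (Q * ?I) * B) *\<^sub>v p"
    using carrier I by (simp add: assoc_mult_mat[of R m n Q n ?I n] assoc_mult_mat_vec[of "R * (Q * ?I)" m n B n])
  also have "R * (Q * ?I) * B = R * ((Q * ?I) * B)"
    using carrier I by (intro assoc_mult_mat[of R m n "Q * ?I" n B n]) auto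
  finally show ?thesis using cancel carrier by simp
qed

section \<open>Factorization through the latent variable\<close>

lemma measurable_count_space_pred:
  assumes "X \<in> measurable M (count_space V)"
  shows "Measurable.pred M (\<lambda>\<omega>. P (X \<omega>))"
  using measurable_compose[OF assms, of P "count_space UNIV"] by simp

lemma measurable_count_space_Pair:
  assumes "X \<in> measurable M (count_space V)" "Y \<in> measurable M (count_space V')"
    and "finite V" "finite V'"
  shows "(\<lambda>\<omega>. (X \<omega>, Y \<omega>)) \<in> measurable M (count_space (V \<times> V'))"
  using measurable_Pair[OF assms(1,2)] assms(3,4)
  by (simp add: pair_measure_countable countable_finite)

section \<open>Sums over finite value sets and conditional independence of events\<close>

context prob_space
begin

text \<open>A predicate \<open>Q\<close> in place of one value covers coarse values and, when always
  true, the law of total probability.\<close>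

lemma prob_sum_values:
  assumes X: "random_variable (count_space V) X" and fin: "finite V" and E: "Measurable.pred M E"
  shows "\<P>(\<omega> in M. Q (X \<omega>) \<and> E \<omega>) = (\<Sum>x\<in>{x\<in>V. Q x}. \<P>(\<omega> in M. X \<omega> = x \<and> E \<omega>))"
proof -
  let ?B = "\<lambda>x. {\<omega>\<in>space M. X \<omega> = x \<and> E \<omega>}"
  have ev: "?B x \<in> events" for x
    using measurable_count_space_pred[OF X, of "\<lambda>y. y = x"] E by measurable
  have "{\<omega>\<in>space M. Q (X \<omega>) \<and> E \<omega>} = (\<Union>x\<in>{x\<in>V. Q x}. ?B x)"
    using measurable_space[OF X] by auto
  also have "prob \<dots> = (\<Sum>x\<in>{x\<in>V. Q x}. prob (?B x))"
    using fin ev by (intro finite_measure_finite_Union) (auto simp: disjoint_family_on_def)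
  finally show ?thesis .
qed

lemma prob_mono_pred:
  assumes "Measurable.pred M Q" "\<And>\<omega>. \<omega> \<in> space M \<Longrightarrow> P \<omega> \<Longrightarrow> Q \<omega>"
  shows "\<P>(\<omega> in M. P \<omega>) \<le> \<P>(\<omega> in M. Q \<omega>)"
  using assms by (intro finite_measure_mono) auto

lemma prob_eq_0_pred:
  assumes "\<P>(\<omega> in M. Q \<omega>) = 0" "Measurable.pred M Q" "\<And>\<omega>. \<omega> \<in> space M \<Longrightarrow> P \<omega> \<Longrightarrow> Q \<omega>"
  shows "\<P>(\<omega> in M. P \<omega>) = 0"
  using prob_mono_pred[OF assms(2,3)] assms(1) measure_nonneg[of M] by (metis order_antisym)

text \<open>With denominators cleared the identity extends to null values \<open>c\<close>, where
  both sides are zero.\<close>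

lemma cond_indep_prod:
  assumes "cond_indep M X Y C" and C: "Measurable.pred M (\<lambda>\<omega>. C \<omega> = c)"
  shows "\<P>(\<omega> in M. X \<omega> = x \<and> Y \<omega> = y \<and> C \<omega> = c) * \<P>(\<omega> in M. C \<omega> = c) =
    \<P>(\<omega> in M. X \<omega> = x \<and> C \<omega> = c) * \<P>(\<omega> in M. Y \<omega> = y \<and> C \<omega> = c)"
proof (cases "\<P>(\<omega> in M. C \<omega> = c) = 0")
  case True
  then have "\<P>(\<omega> in M. X \<omega> = x \<and> C \<omega> = c) = 0" by (rule prob_eq_0_pred[OF _ C]) auto
  with True show ?thesis by simp
next
  case False
  then have pos: "\<P>(\<omega> in M. C \<omega> = c) > 0" using measure_nonneg[of M] by (simp add: less_le)
  then have "c \<in> rv_support M C" by (simp add: rv_support_def)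
  then have "\<P>(\<omega> in M. X \<omega> = x \<and> Y \<omega> = y \<bar> C \<omega> = c) =
     \<P>(\<omega> in M. X \<omega> = x \<bar> C \<omega> = c) * \<P>(\<omega> in M. Y \<omega> = y \<bar> C \<omega> = c)"
    using assms(1) unfolding cond_indep_def by blast
  then show ?thesis using False by (simp add: cond_prob_def conj_assoc field_simps)
qed

text \<open>Summing the product form over values passes from values to events, as coarsenings
  require.\<close>

lemma cond_indep_pred:
  assumes "cond_indep M X Y C" and C: "Measurable.pred M (\<lambda>\<omega>. C \<omega> = c)"
    and X: "random_variable (count_space V) X" "finite V"
    and Y: "random_variable (count_space V') Y" "finite V'"
  shows "\<P>(\<omega> in M. P (X \<omega>) \<and> Q (Y \<omega>) \<and> C \<omega> = c) * \<P>(\<omega> in M. C \<omega> = c) =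
    \<P>(\<omega> in M. P (X \<omega>) \<and> C \<omega> = c) * \<P>(\<omega> in M. Q (Y \<omega>) \<and> C \<omega> = c)"
proof -
  have QC: "Measurable.pred M (\<lambda>\<omega>. Q (Y \<omega>) \<and> C \<omega> = c)"
    using measurable_count_space_pred[OF Y(1)] C by measurable
  have XC: "Measurable.pred M (\<lambda>\<omega>. X \<omega> = x \<and> C \<omega> = c)" for x
    using measurable_count_space_pred[OF X(1), of "\<lambda>y. y = x"] C by measurable
  have "\<P>(\<omega> in M. X \<omega> = x \<and> Q (Y \<omega>) \<and> C \<omega> = c) =
      (\<Sum>y\<in>{y\<in>V'. Q y}. \<P>(\<omega> in M. X \<omega> = x \<and> Y \<omega> = y \<and> C \<omega> = c))" for x
    using prob_sum_values[OF Y XC[of x], of Q] by (simp add: conj_ac)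
  then have "\<P>(\<omega> in M. P (X \<omega>) \<and> Q (Y \<omega>) \<and> C \<omega> = c) =
      (\<Sum>x\<in>{x\<in>V. P x}. \<Sum>y\<in>{y\<in>V'. Q y}. \<P>(\<omega> in M. X \<omega> = x \<and> Y \<omega> = y \<and> C \<omega> = c))"
    using prob_sum_values[OF X QC, of P] by simp
  moreover have "\<P>(\<omega> in M. P (X \<omega>) \<and> C \<omega> = c) = (\<Sum>x\<in>{x\<in>V. P x}. \<P>(\<omega> in M. X \<omega> = x \<and> C \<omega> = c))"
    "\<P>(\<omega> in M. Q (Y \<omega>) \<and> C \<omega> = c) = (\<Sum>y\<in>{y\<in>V'. Q y}. \<P>(\<omega> in M. Y \<omega> = y \<and> C \<omega> = c))"
    using prob_sum_values[OF X C, of P] prob_sum_values[OF Y C, of Q] by simp_all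
  ultimately show ?thesis
    by (simp only: sum_product) (simp add: sum_distrib_right cond_indep_prod[OF assms(1) C])
qed

end

section \<open>Observed and interventional probabilities as mixtures over the latent
  variable\<close>

context proxy_model
begin

lemma pred_values [measurable]:
  "Measurable.pred M (\<lambda>\<omega>. P (Z \<omega>))"
  "Measurable.pred M (\<lambda>\<omega>. P' (S \<omega>))"
  "Measurable.pred M (\<lambda>\<omega>. P'' (W \<omega>))"
  "Measurable.pred M (\<lambda>\<omega>. P\<^sub>1 (U \<omega>))"
  "Measurable.pred M (\<lambda>\<omega>. P\<^sub>2 (A \<omega>))"
  using rv_Z rv_S rv_W rv_U rv_A by (auto intro: measurable_count_space_pred)

lemma support_in_values: "s \<in> rv_support M S \<Longrightarrow> s \<in> VS"
proof (rule ccontr)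
  assume s: "s \<in> rv_support M S" "s \<notin> VS"
  then have "{\<omega>\<in>space M. S \<omega> = s} = {}" using measurable_space[OF rv_S] by auto
  then have "\<P>(\<omega> in M. S \<omega> = s) = 0" by (simp only: measure_empty)
  then show False using s by (simp add: rv_support_def)
qed

lemma prob_sum_latent:
  assumes "Measurable.pred M E"
  shows "\<P>(\<omega> in M. E \<omega>) = (\<Sum>u\<in>VU. \<P>(\<omega> in M. E \<omega> \<and> U \<omega> = u))"
  using prob_sum_values[OF rv_U finite_values(4) assms, of "\<lambda>_. True"] by (simp add: conj_commute)

text \<open>Given \<open>U = u\<close>, the measurement is independent of \<open>(Z, S)\<close>, so
  each latent term splits; a null \<open>u\<close> contributes zero on both sides.\<close>

lemma measurement_factor:
  "\<P>(\<omega> in M. \<psi> (W \<omega>) \<and> \<zeta> (Z \<omega>) \<and> S \<omega> = s) =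
    (\<Sum>u\<in>VU. \<P>(\<omega> in M. \<psi> (W \<omega>) \<bar> U \<omega> = u) * \<P>(\<omega> in M. \<zeta> (Z \<omega>) \<and> S \<omega> = s \<and> U \<omega> = u))"
proof -
  have ZS: "random_variable (count_space (VZ \<times> VS)) (\<lambda>\<omega>. (Z \<omega>, S \<omega>))"
    using measurable_count_space_Pair rv_Z rv_S finite_values by blast
  have "\<P>(\<omega> in M. (\<psi> (W \<omega>) \<and> \<zeta> (Z \<omega>) \<and> S \<omega> = s) \<and> U \<omega> = u) =
      \<P>(\<omega> in M. \<psi> (W \<omega>) \<bar> U \<omega> = u) * \<P>(\<omega> in M. \<zeta> (Z \<omega>) \<and> S \<omega> = s \<and> U \<omega> = u)" for u
  proof (cases "\<P>(\<omega> in M. U \<omega> = u) = 0")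
    case True
    have "\<P>(\<omega> in M. (\<psi> (W \<omega>) \<and> \<zeta> (Z \<omega>) \<and> S \<omega> = s) \<and> U \<omega> = u) = 0"
      by (rule prob_eq_0_pred[OF True]) auto
    with True show ?thesis by (simp add: cond_prob_def)
  next
    case False
    have "\<P>(\<omega> in M. (\<zeta> (Z \<omega>) \<and> S \<omega> = s) \<and> \<psi> (W \<omega>) \<and> U \<omega> = u) * \<P>(\<omega> in M. U \<omega> = u) =
        \<P>(\<omega> in M. (\<zeta> (Z \<omega>) \<and> S \<omega> = s) \<and> U \<omega> = u) * \<P>(\<omega> in M. \<psi> (W \<omega>) \<and> U \<omega> = u)"
      using cond_indep_pred[OF measurement_proxy _ ZS _ rv_W, of u "\<lambda>(z, s'). \<zeta> z \<and> s' = s" \<psi>]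
        finite_values by simp
    then show ?thesis using False by (simp add: cond_prob_def field_simps conj_ac)
  qed
  then show ?thesis by (subst prob_sum_latent) auto
qed

text \<open>Given the pair \<open>(S, U)\<close>, the action is independent of \<open>Z\<close>, so
  its factor does not involve \<open>\<zeta>\<close>. The remaining factor is the one in
  \<open>measurement_factor\<close>, which is what lets the two matrices share
  \<open>Q\<close>.\<close>

lemma action_factor:
  "\<P>(\<omega> in M. A \<omega> = a \<and> \<zeta> (Z \<omega>) \<and> S \<omega> = s) =
    (\<Sum>u\<in>VU. \<P>(\<omega> in M. A \<omega> = a \<bar> S \<omega> = s \<and> U \<omega> = u) *
      \<P>(\<omega> in M. \<zeta> (Z \<omega>) \<and> S \<omega> = s \<and> U \<omega> = u))"
proof -
  have "\<P>(\<omega> in M. (A \<omega> = a \<and> \<zeta> (Z \<omega>) \<and> S \<omega> = s) \<and> U \<omega> = u) =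
      \<P>(\<omega> in M. A \<omega> = a \<bar> S \<omega> = s \<and> U \<omega> = u) *
      \<P>(\<omega> in M. \<zeta> (Z \<omega>) \<and> S \<omega> = s \<and> U \<omega> = u)" for u
  proof (cases "\<P>(\<omega> in M. S \<omega> = s \<and> U \<omega> = u) = 0")
    case True
    have "\<P>(\<omega> in M. (A \<omega> = a \<and> \<zeta> (Z \<omega>) \<and> S \<omega> = s) \<and> U \<omega> = u) = 0"
      by (rule prob_eq_0_pred[OF True]) auto
    with True show ?thesis by (simp add: cond_prob_def)
  next
    case False
    have "\<P>(\<omega> in M. \<zeta> (Z \<omega>) \<and> A \<omega> = a \<and> S \<omega> = s \<and> U \<omega> = u) * \<P>(\<omega> in M. S \<omega> = s \<and> U \<omega> = u) =
        \<P>(\<omega> in M. \<zeta> (Z \<omega>) \<and> S \<omega> = s \<and> U \<omega> = u) * \<P>(\<omega> in M. A \<omega> = a \<and> S \<omega> = s \<and> U \<omega> = u)"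
      using cond_indep_pred[OF action_proxy _ rv_Z _ rv_A, of "(s, u)" \<zeta> "\<lambda>a'. a' = a"]
        finite_values by simp
    then show ?thesis using False by (simp add: cond_prob_def field_simps conj_ac)
  qed
  then show ?thesis by (subst prob_sum_latent) auto
qed

text \<open>For non-null \<open>u\<close>, exchangeability gives
  \<open>p(A^(s) = a | u) = p(A^(s) = a | s, u)\<close>, and consistency replaces the potential
  action by \<open>A\<close> on the event \<open>S = s\<close>.\<close>

lemma potential_action_factor:
  assumes s: "s \<in> rv_support M S"
  shows "\<P>(\<omega> in M. Apot s \<omega> = a) =
    (\<Sum>u\<in>VU. \<P>(\<omega> in M. A \<omega> = a \<bar> S \<omega> = s \<and> U \<omega> = u) * \<P>(\<omega> in M. U \<omega> = u))"
proof -
  have sV: "s \<in> VS" using s by (rule support_in_values)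
  have [measurable]: "Measurable.pred M (\<lambda>\<omega>. Apot s \<omega> = a)"
    using measurable_count_space_pred[OF rv_Apot[OF sV], of "\<lambda>a'. a' = a"] .
  have "\<P>(\<omega> in M. Apot s \<omega> = a \<and> U \<omega> = u) =
      \<P>(\<omega> in M. A \<omega> = a \<bar> S \<omega> = s \<and> U \<omega> = u) * \<P>(\<omega> in M. U \<omega> = u)" for u
  proof (cases "\<P>(\<omega> in M. U \<omega> = u) = 0")
    case True
    have "\<P>(\<omega> in M. Apot s \<omega> = a \<and> U \<omega> = u) = 0"
      by (rule prob_eq_0_pred[OF True]) auto
    with True show ?thesis by simp
  next
    case False
    then have "u \<in> rv_support M U" using measure_nonneg[of M] by (simp add: rv_support_def less_le)
    \<comment> \<open>Otherwise the conditional probability of \<open>A\<close> given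
      \<open>(s, u)\<close> would be the default value zero of a division by zero.\<close>
    from positivity[OF this s] have pos: "\<P>(\<omega> in M. S \<omega> = s \<and> U \<omega> = u) \<noteq> 0"
      by (auto simp: cond_prob_def)
    have "\<P>(\<omega> in M. Apot s \<omega> = a \<and> S \<omega> = s \<and> U \<omega> = u) * \<P>(\<omega> in M. U \<omega> = u) =
        \<P>(\<omega> in M. Apot s \<omega> = a \<and> U \<omega> = u) * \<P>(\<omega> in M. S \<omega> = s \<and> U \<omega> = u)"
      by (rule cond_indep_prod[OF latent_exchangeability[OF sV]]) simp
    moreover have "\<P>(\<omega> in M. Apot s \<omega> = a \<and> S \<omega> = s \<and> U \<omega> = u) =
        \<P>(\<omega> in M. A \<omega> = a \<and> S \<omega> = s \<and> U \<omega> = u)"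
      using consistency[OF s] by (intro finite_measure_eq_AE) (auto elim!: AE_mp)
    ultimately show ?thesis using pos by (simp add: cond_prob_def field_simps)
  qed
  then show ?thesis by (subst prob_sum_latent) auto
qed

lemma measurement_marginal:
  "\<P>(\<omega> in M. \<psi> (W \<omega>)) =
    (\<Sum>u\<in>VU. \<P>(\<omega> in M. \<psi> (W \<omega>) \<bar> U \<omega> = u) * \<P>(\<omega> in M. U \<omega> = u))"
proof -
  have "\<P>(\<omega> in M. \<psi> (W \<omega>) \<and> U \<omega> = u) =
      \<P>(\<omega> in M. \<psi> (W \<omega>) \<bar> U \<omega> = u) * \<P>(\<omega> in M. U \<omega> = u)" for u
  proof (cases "\<P>(\<omega> in M. U \<omega> = u) = 0")
    case True
    have "\<P>(\<omega> in M. \<psi> (W \<omega>) \<and> U \<omega> = u) = 0" by (rule prob_eq_0_pred[OF True]) auto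
    with True show ?thesis by simp
  qed (simp add: cond_prob_def)
  then show ?thesis by (subst prob_sum_latent) auto
qed

text \<open>Block sums of the fine joint probabilities are the shape that
  \<open>row_column_grouping\<close> produces.\<close>

lemma prob_coarse:
  "\<P>(\<omega> in M. \<psi> (W \<omega>) \<and> \<zeta> (Z \<omega>) \<and> S \<omega> = s) =
    (\<Sum>z\<in>{z\<in>VZ. \<zeta> z}. \<Sum>w\<in>{w\<in>VW. \<psi> w}. \<P>(\<omega> in M. W \<omega> = w \<and> Z \<omega> = z \<and> S \<omega> = s))"
proof -
  have "\<P>(\<omega> in M. \<zeta> (Z \<omega>) \<and> \<psi> (W \<omega>) \<and> S \<omega> = s) =
      (\<Sum>z\<in>{z\<in>VZ. \<zeta> z}. \<P>(\<omega> in M. Z \<omega> = z \<and> \<psi> (W \<omega>) \<and> S \<omega> = s))"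
    by (rule prob_sum_values[OF rv_Z finite_values(1)]) measurable
  also have "\<dots> = (\<Sum>z\<in>{z\<in>VZ. \<zeta> z}. \<P>(\<omega> in M. \<psi> (W \<omega>) \<and> Z \<omega> = z \<and> S \<omega> = s))"
    by (simp add: conj_left_commute)
  also have "\<dots> = (\<Sum>z\<in>{z\<in>VZ. \<zeta> z}. \<Sum>w\<in>{w\<in>VW. \<psi> w}. \<P>(\<omega> in M. W \<omega> = w \<and> Z \<omega> = z \<and> S \<omega> = s))"
    by (intro sum.cong refl prob_sum_values[OF rv_W finite_values(3)]) measurable
  finally show ?thesis by (simp add: conj_left_commute)
qed

end

section \<open>The factorizations in matrix form\<close>

text \<open>The right-hand side of the identification formula. It refers only to a measure and the
  observed variables, so it can also be evaluated at the observed law.\<close>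

definition proxy_formula ::
  "'m measure \<Rightarrow> ('m \<Rightarrow> 'a) \<Rightarrow> 'a set \<Rightarrow> ('m \<Rightarrow> 'w) \<Rightarrow> ('m \<Rightarrow> 'z) \<Rightarrow> 'k set \<Rightarrow> ('m \<Rightarrow> 's) \<Rightarrow> 's \<Rightarrow>
   ('z \<Rightarrow> 'k) \<Rightarrow> ('w \<Rightarrow> 'k) \<Rightarrow> real Matrix.vec" where
  "proxy_formula M A VA W Z K S s \<phi>Z \<phi>W =
     (cond_mat M A VA (\<phi>Z \<circ> Z) K S s *
      the (mat_inverse (cond_mat M (\<phi>W \<circ> W) K (\<phi>Z \<circ> Z) K S s))) *\<^sub>v prob_vec M (\<phi>W \<circ> W) K"

lemma cond_mat_factorI:
  assumes "\<And>x z. \<P>(\<omega> in M. X \<omega> = x \<bar> Z \<omega> = z \<and> S \<omega> = s) =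
      (\<Sum>u\<in>VU. g x u * \<P>(\<omega> in M. U \<omega> = u \<bar> Z \<omega> = z \<and> S \<omega> = s))"
  shows "cond_mat M X VX Z VZ S s =
    Matrix.mat (card VX) (card VU) (\<lambda>(i, j). g (from_nat_into VX i) (from_nat_into VU j)) *
    cond_mat M U VU Z VZ S s"
proof (rule eq_matI, goal_cases)
  case (1 i j)
  then have ij: "i < card VX" "j < card VZ" by (auto simp: cond_mat_def)
  then show ?case
    using sum.card_from_nat_into[of "\<lambda>u. g (from_nat_into VX i) u *
        \<P>(\<omega> in M. U \<omega> = u \<bar> Z \<omega> = from_nat_into VZ j \<and> S \<omega> = s)" VU]
    by (simp add: cond_mat_def scalar_prod_def atLeast0LessThan assms)
qed (auto simp: cond_mat_def)

lemma prob_vec_factorI: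
  assumes "\<And>x. \<P>(\<omega> in M. X \<omega> = x) = (\<Sum>u\<in>VU. g x u * \<P>(\<omega> in M. U \<omega> = u))"
  shows "prob_vec M X VX =
    Matrix.mat (card VX) (card VU) (\<lambda>(i, j). g (from_nat_into VX i) (from_nat_into VU j)) *\<^sub>v
    prob_vec M U VU"
proof (rule eq_vecI, goal_cases)
  case (1 i)
  then have i: "i < card VX" by simp
  then show ?case
    using sum.card_from_nat_into[of "\<lambda>u. g (from_nat_into VX i) u * \<P>(\<omega> in M. U \<omega> = u)" VU]
    by (simp add: prob_vec_def scalar_prod_def atLeast0LessThan assms)
qed (simp add: prob_vec_def)

context proxy_model
begin

text \<open>This is \<open>B\<close> of the overview; \<open>action_mat\<close> is \<open>R\<close>,
  and \<open>Q\<close> is \<open>cond_mat\<close> applied to \<open>U\<close>.\<close>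

definition measurement_mat :: "('w \<Rightarrow> 'k) \<Rightarrow> 'k set \<Rightarrow> real mat" where
  "measurement_mat \<psi> L = Matrix.mat (card L) (card VU) (\<lambda>(i, j).
      \<P>(\<omega> in M. (\<psi> \<circ> W) \<omega> = from_nat_into L i \<bar> U \<omega> = from_nat_into VU j))"

definition action_mat :: "'s \<Rightarrow> real mat" where
  "action_mat s = Matrix.mat (card VA) (card VU) (\<lambda>(i, j).
      \<P>(\<omega> in M. A \<omega> = from_nat_into VA i \<bar> S \<omega> = s \<and> U \<omega> = from_nat_into VU j))"

lemma cond_prob_latent:
  "\<P>(\<omega> in M. U \<omega> = u \<bar> \<zeta> (Z \<omega>) \<and> S \<omega> = s) =
    \<P>(\<omega> in M. \<zeta> (Z \<omega>) \<and> S \<omega> = s \<and> U \<omega> = u) / \<P>(\<omega> in M. \<zeta> (Z \<omega>) \<and> S \<omega> = s)"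
  by (simp add: cond_prob_def conj_ac)

lemma cond_mat_measurement_factor:
  "cond_mat M (\<psi> \<circ> W) L (\<phi> \<circ> Z) K S s = measurement_mat \<psi> L * cond_mat M U VU (\<phi> \<circ> Z) K S s"
  unfolding measurement_mat_def
proof (rule cond_mat_factorI)
  fix l k
  show "\<P>(\<omega> in M. (\<psi> \<circ> W) \<omega> = l \<bar> (\<phi> \<circ> Z) \<omega> = k \<and> S \<omega> = s) =
      (\<Sum>u\<in>VU. \<P>(\<omega> in M. (\<psi> \<circ> W) \<omega> = l \<bar> U \<omega> = u) *
        \<P>(\<omega> in M. U \<omega> = u \<bar> (\<phi> \<circ> Z) \<omega> = k \<and> S \<omega> = s))"
    using measurement_factor[of "\<lambda>w. \<psi> w = l" "\<lambda>z. \<phi> z = k" s]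
    by (simp add: cond_prob_latent[where \<zeta> = "\<lambda>z. \<phi> z = k"] sum_divide_distrib
        cond_prob_def[of M _ "\<lambda>\<omega>. \<phi> (Z \<omega>) = k \<and> S \<omega> = s"])
qed

lemma cond_mat_action_factor:
  "cond_mat M A VA (\<phi> \<circ> Z) K S s = action_mat s * cond_mat M U VU (\<phi> \<circ> Z) K S s"
  unfolding action_mat_def
proof (rule cond_mat_factorI)
  fix a k
  show "\<P>(\<omega> in M. A \<omega> = a \<bar> (\<phi> \<circ> Z) \<omega> = k \<and> S \<omega> = s) =
      (\<Sum>u\<in>VU. \<P>(\<omega> in M. A \<omega> = a \<bar> S \<omega> = s \<and> U \<omega> = u) *
        \<P>(\<omega> in M. U \<omega> = u \<bar> (\<phi> \<circ> Z) \<omega> = k \<and> S \<omega> = s))"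
    using action_factor[of a "\<lambda>z. \<phi> z = k" s]
    by (simp add: cond_prob_latent[where \<zeta> = "\<lambda>z. \<phi> z = k"] sum_divide_distrib
        cond_prob_def[of M _ "\<lambda>\<omega>. \<phi> (Z \<omega>) = k \<and> S \<omega> = s"])
qed

lemma prob_vec_measurement_factor:
  "prob_vec M (\<psi> \<circ> W) L = measurement_mat \<psi> L *\<^sub>v prob_vec M U VU"
  unfolding measurement_mat_def
  by (rule prob_vec_factorI) (simp add: measurement_marginal[where \<psi> = "\<lambda>w. \<psi> w = _"])

lemma prob_vec_potential_action_factor:
  assumes "s \<in> rv_support M S"
  shows "prob_vec M (Apot s) VA = action_mat s *\<^sub>v prob_vec M U VU"
  unfolding action_mat_def by (rule prob_vec_factorI) (rule potential_action_factor[OF assms])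

text \<open>All ingredients are factored by now; \<open>card K = card VU\<close> makes
  \<open>B\<close> and \<open>Q\<close> square, so that they cancel.\<close>

lemma potential_action_formula:
  assumes "s \<in> rv_support M S" "card K = card VU"
    and "invertible_mat (cond_mat M (\<phi>W \<circ> W) K (\<phi>Z \<circ> Z) K S s)"
  shows "prob_vec M (Apot s) VA = proxy_formula M A VA W Z K S s \<phi>Z \<phi>W"
proof -
  let ?n = "card VU" and ?Q = "cond_mat M U VU (\<phi>Z \<circ> Z) K S s"
  have "measurement_mat \<phi>W K \<in> carrier_mat ?n ?n" "?Q \<in> carrier_mat ?n ?n"
    "action_mat s \<in> carrier_mat (card VA) ?n" "prob_vec M U VU \<in> carrier_vec ?n"
    using assms(2) by (auto simp: cond_mat_def prob_vec_def measurement_mat_def action_mat_def)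
  from factored_inverse_cancel[OF this] show ?thesis
    using assms(3) by (simp add: proxy_formula_def cond_mat_measurement_factor
        cond_mat_action_factor prob_vec_measurement_factor prob_vec_potential_action_factor[OF assms(1)])
qed

section \<open>Comparing the two rank conditions\<close>

text \<open>Normalising by the probability of the coarse conditioning event scales the rows of the
  joint family; a null event rules out both sides. What remains concerns joint probabilities
  only.\<close>

lemma invertible_coarse_iff:
  assumes "finite K"
  shows "invertible_mat (cond_mat M (\<psi> \<circ> W) K (\<phi> \<circ> Z) K S s) \<longleftrightarrow>
    rows_indep (\<lambda>k l. \<Sum>z\<in>{z\<in>VZ. \<phi> z = k}. \<Sum>w\<in>{w\<in>VW. \<psi> w = l}.
      \<P>(\<omega> in M. W \<omega> = w \<and> Z \<omega> = z \<and> S \<omega> = s)) K K"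
proof -
  let ?f = "\<lambda>k l. \<P>(\<omega> in M. \<psi> (W \<omega>) = l \<and> \<phi> (Z \<omega>) = k \<and> S \<omega> = s)"
  let ?p = "\<lambda>k. \<P>(\<omega> in M. \<phi> (Z \<omega>) = k \<and> S \<omega> = s)"
  have "cond_mat M (\<psi> \<circ> W) K (\<phi> \<circ> Z) K S s = Matrix.mat (card K) (card K)
      (\<lambda>(i, j). (\<lambda>k l. ?f k l / ?p k) (from_nat_into K j) (from_nat_into K i))"
    by (simp add: cond_mat_def cond_prob_def)
  then have "invertible_mat (cond_mat M (\<psi> \<circ> W) K (\<phi> \<circ> Z) K S s) \<longleftrightarrow>
      rows_indep (\<lambda>k l. ?f k l / ?p k) K K"
    using invertible_mat_enum_iff[OF assms assms refl, of "\<lambda>k l. ?f k l / ?p k"] by simp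
  also have "\<dots> \<longleftrightarrow> rows_indep ?f K K"
  proof (rule rows_indep_divide[OF assms])
    fix k l assume "?p k = 0"
    then show "?f k l = 0" by (rule prob_eq_0_pred) auto
  qed
  finally show ?thesis
    unfolding prob_coarse[where \<psi> = "\<lambda>w. \<psi> w = _" and \<zeta> = "\<lambda>z. \<phi> z = _"] .
qed

lemma rank_iff_invertible_coarsening:
  assumes s: "s \<in> rv_support M S" and K: "finite K" "card K = card VU"
  shows "mat_rank (cond_mat M W VW Z VZ S s) = card VU \<longleftrightarrow>
    (\<exists>\<phi>\<in>VZ \<rightarrow> K. \<exists>\<psi>\<in>VW \<rightarrow> K. invertible_mat (cond_mat M (\<psi> \<circ> W) K (\<phi> \<circ> Z) K S s))"
proof -
  let ?f = "\<lambda>z w. \<P>(\<omega> in M. W \<omega> = w \<and> Z \<omega> = z \<and> S \<omega> = s)"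
  let ?p = "\<lambda>z. \<P>(\<omega> in M. Z \<omega> = z \<and> S \<omega> = s)"
  let ?h = "\<lambda>\<phi> \<psi> k l. \<Sum>z\<in>{z\<in>VZ. \<phi> z = k}. \<Sum>w\<in>{w\<in>VW. \<psi> w = l}. ?f z w"
  obtain B where B: "row_basis ?f VZ VW B" using row_basis_exists[OF finite_values(1)] by blast
  obtain c where BZ: "B \<subseteq> VZ" and Bind: "rows_indep ?f B VW"
    and c: "\<And>z w. z \<in> VZ \<Longrightarrow> w \<in> VW \<Longrightarrow> ?f z w = (\<Sum>b\<in>B. c z b * ?f b w)"
    using B unfolding row_basis_def by blast
  have finB: "finite B" using BZ finite_values(1) finite_subset by blast
  \<comment> \<open>\<open>well_defined\<close> makes the fine conditioning events non-null, so the
    division is a true rescaling.\<close>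
  have "row_basis (\<lambda>z w. ?f z w / ?p z) VZ VW B"
    using B by (rule row_basis_divide) (use well_defined[OF _ s] in force)
  from mat_rank_enum[OF finite_values(3,1) this]
  have rank: "mat_rank (cond_mat M W VW Z VZ S s) = card B"
    by (simp add: cond_mat_def cond_prob_def)
  show ?thesis unfolding rank
  proof
    assume card: "card B = card VU"
    have "(\<Sum>z\<in>VZ. \<Sum>w\<in>VW. ?f z w) = \<P>(\<omega> in M. S \<omega> = s)"
      using prob_coarse[of "\<lambda>_. True" "\<lambda>_. True" s] by simp
    also have "\<dots> \<noteq> 0" using s by (simp add: rv_support_def)
    finally have "(\<Sum>z\<in>VZ. \<Sum>w\<in>VW. ?f z w) \<noteq> 0" .
    with row_column_grouping[OF finite_values(1,3) K(1) B] card K(2)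
    have "\<exists>\<phi>\<in>VZ \<rightarrow> K. \<exists>\<psi>\<in>VW \<rightarrow> K. rows_indep (?h \<phi> \<psi>) K K" by simp
    then show "\<exists>\<phi>\<in>VZ \<rightarrow> K. \<exists>\<psi>\<in>VW \<rightarrow> K. invertible_mat (cond_mat M (\<psi> \<circ> W) K (\<phi> \<circ> Z) K S s)"
      unfolding invertible_coarse_iff[OF K(1)] .
  next
    assume "\<exists>\<phi>\<in>VZ \<rightarrow> K. \<exists>\<psi>\<in>VW \<rightarrow> K. invertible_mat (cond_mat M (\<psi> \<circ> W) K (\<phi> \<circ> Z) K S s)"
    then obtain \<phi> \<psi> where h: "rows_indep (?h \<phi> \<psi>) K K"
      unfolding invertible_coarse_iff[OF K(1)] by blast
    \<comment> \<open>Upper bound: the joint family factors through the latent values, so at most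
      \<open>card VU\<close> of its rows are independent.\<close>
    have "rows_indep (\<lambda>z u. \<P>(\<omega> in M. Z \<omega> = z \<and> S \<omega> = s \<and> U \<omega> = u)) B VU"
      by (rule rows_indep_factor[OF Bind, where f = "\<lambda>u w. \<P>(\<omega> in M. W \<omega> = w \<bar> U \<omega> = u)"])
        (simp add: measurement_factor[where \<psi> = "\<lambda>w. w = _" and \<zeta> = "\<lambda>z. z = _"] mult.commute)
    from rows_indep_card_le[OF finite_values(4) finB this] have "card B \<le> card VU" .
    \<comment> \<open>Lower bound: the coarse family factors through the basis rows, with class sums
      of the coordinates \<open>c\<close> as left factor, so \<open>card K\<close> is at most
      \<open>card B\<close>.\<close>
    moreover have "rows_indep (\<lambda>k b. \<Sum>z\<in>{z\<in>VZ. \<phi> z = k}. c z b) K B"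
    proof (rule rows_indep_factor[OF h, where f = "\<lambda>b l. \<Sum>w\<in>{w\<in>VW. \<psi> w = l}. ?f b w"])
      fix k l
      have "?h \<phi> \<psi> k l = (\<Sum>z\<in>{z\<in>VZ. \<phi> z = k}. \<Sum>w\<in>{w\<in>VW. \<psi> w = l}. \<Sum>b\<in>B. c z b * ?f b w)"
        using c by (intro sum.cong refl) auto
      also have "\<dots> = (\<Sum>z\<in>{z\<in>VZ. \<phi> z = k}. \<Sum>b\<in>B. \<Sum>w\<in>{w\<in>VW. \<psi> w = l}. c z b * ?f b w)"
        by (intro sum.cong refl sum.swap)
      also have "\<dots> = (\<Sum>b\<in>B. \<Sum>z\<in>{z\<in>VZ. \<phi> z = k}. \<Sum>w\<in>{w\<in>VW. \<psi> w = l}. c z b * ?f b w)"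
        by (rule sum.swap)
      finally show "?h \<phi> \<psi> k l = (\<Sum>b\<in>B. (\<Sum>z\<in>{z\<in>VZ. \<phi> z = k}. c z b) *
          (\<Sum>w\<in>{w\<in>VW. \<psi> w = l}. ?f b w))"
        by (simp only: sum_product)
    qed
    from rows_indep_card_le[OF finB K(1) this] have "card VU \<le> card B" using K(2) by simp
    ultimately show "card B = card VU" by simp
  qed
qed

end

section \<open>Identification\<close>

text \<open>The number of latent categories is read off from the observed law as a rank.  All
  invertible coarsenings give the same vector, so the choice by \<open>SOME\<close> is harmless.\<close>
definition identified_probs ::
  "'m measure \<Rightarrow> ('m \<Rightarrow> 'z) \<Rightarrow> ('m \<Rightarrow> 's) \<Rightarrow> ('m \<Rightarrow> 'w) \<Rightarrow> ('m \<Rightarrow> 'a) \<Rightarrow>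
   'z set \<Rightarrow> 'w set \<Rightarrow> 'a set \<Rightarrow> 's \<Rightarrow> real Matrix.vec" where
  "identified_probs M Z S W A VZ VW VA s =
     (let K = {1..mat_rank (cond_mat M W VW Z VZ S s)};
          (\<phi>Z, \<phi>W) = (SOME (\<phi>, \<psi>). invertible_mat (cond_mat M (\<psi> \<circ> W) K (\<phi> \<circ> Z) K S s))
      in proxy_formula M A VA W Z K S s \<phi>Z \<phi>W)"

lemma (in proxy_model) potential_action_identified:
  assumes s: "s \<in> rv_support M S" and "rank_condition M Z S W VZ VW (card VU)"
  shows "prob_vec M (Apot s) VA = identified_probs M Z S W A VZ VW VA s"
proof -
  have rank: "mat_rank (cond_mat M W VW Z VZ S s) = card VU"
    using assms by (simp add: rank_condition_def)
  let ?K = "{1..card VU}"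
  let ?P = "\<lambda>(\<phi>, \<psi>). invertible_mat (cond_mat M (\<psi> \<circ> W) ?K (\<phi> \<circ> Z) ?K S s)"
  \<comment> \<open>Existence comes from coarsenings into \<open>?K\<close>. The choice ranges over
    all functions on the types, and the formula holds for every pair it can return.\<close>
  have "\<exists>p. ?P p" using rank rank_iff_invertible_coarsening[OF s, of ?K] by auto
  from someI_ex[OF this] have P: "?P (SOME p. ?P p)" .
  obtain \<phi>Z \<phi>W where eq: "(SOME p. ?P p) = (\<phi>Z, \<phi>W)" by fastforce
  have "prob_vec M (Apot s) VA = proxy_formula M A VA W Z ?K S s \<phi>Z \<phi>W"
    using P unfolding eq by (intro potential_action_formula[OF s]) auto
  then show ?thesis unfolding identified_probs_def Let_def rank eq by simp
qed

section \<open>Evaluation at the observed law\<close>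

context
  fixes M :: "'m measure" and N :: "'n measure" and X :: "'m \<Rightarrow> 'n"
  assumes X: "X \<in> measurable M N" and all_sets: "sets N = Pow (space N)"
begin

text \<open>\<open>all_sets\<close> makes every predicate on \<open>N\<close> an event, so any
  expression built from probabilities takes the same value at the image law.\<close>

lemma prob_distr: "\<P>(x in distr M N X. P x) = \<P>(\<omega> in M. P (X \<omega>))"
proof -
  have "X -` {x\<in>space N. P x} \<inter> space M = {\<omega>\<in>space M. P (X \<omega>)}"
    using measurable_space[OF X] by auto
  then show ?thesis using X by (simp add: measure_distr all_sets)
qed

lemma cond_mat_distr:
  "cond_mat (distr M N X) Y V Z V' S s = cond_mat M (Y \<circ> X) V (Z \<circ> X) V' (S \<circ> X) s"
  by (simp only: cond_mat_def cond_prob_def prob_distr comp_apply)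

lemma prob_vec_distr: "prob_vec (distr M N X) Y V = prob_vec M (Y \<circ> X) V"
  by (simp only: prob_vec_def prob_distr comp_apply)

lemma proxy_formula_distr:
  "proxy_formula (distr M N X) A VA W Z K S s \<phi>Z \<phi>W =
    proxy_formula M (A \<circ> X) VA (W \<circ> X) (Z \<circ> X) K (S \<circ> X) s \<phi>Z \<phi>W"
  by (simp only: proxy_formula_def cond_mat_distr prob_vec_distr comp_assoc)

text \<open>The predicate under \<open>SOME\<close> is rewritten into the very predicate for
  \<open>M\<close>, so both sides choose the same coarsenings.\<close>

lemma identified_probs_distr:
  "identified_probs (distr M N X) Z S W A VZ VW VA s =
    identified_probs M (Z \<circ> X) (S \<circ> X) (W \<circ> X) (A \<circ> X) VZ VW VA s"
  by (simp only: identified_probs_def cond_mat_distr proxy_formula_distr comp_assoc)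

end

text \<open>The law is treated as a probability space of its own whose coordinate projections are
  the observed variables. \<open>to_nat_on VA\<close> inverts the enumeration behind
  \<open>prob_vec\<close>.\<close>

definition identified_prob ::
  "'z set \<Rightarrow> 'w set \<Rightarrow> 'a set \<Rightarrow> ('z \<times> 's \<times> 'w \<times> 'a) measure \<Rightarrow> 's \<Rightarrow> 'a \<Rightarrow> real" where
  "identified_prob VZ VW VA law s a =
     identified_probs law fst (fst \<circ> snd) (fst \<circ> snd \<circ> snd) (snd \<circ> snd \<circ> snd) VZ VW VA s $ to_nat_on VA a"

context proxy_model
begin

lemma identified_probs_observed_law:
  "identified_probs (observed_law M Z S W A VZ VS VW VA)
      fst (fst \<circ> snd) (fst \<circ> snd \<circ> snd) (snd \<circ> snd \<circ> snd) VZ VW VA s =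
    identified_probs M Z S W A VZ VW VA s"
proof -
  have "(\<lambda>\<omega>. (Z \<omega>, S \<omega>, W \<omega>, A \<omega>)) \<in> measurable M (count_space (VZ \<times> VS \<times> VW \<times> VA))"
    using rv_Z rv_S rv_W rv_A finite_values by (intro measurable_count_space_Pair) auto
  then show ?thesis
    unfolding observed_law_def by (subst identified_probs_distr) (simp_all add: comp_def)
qed

lemma interv_prob_identified:
  assumes "s \<in> rv_support M S" "rank_condition M Z S W VZ VW (card VU)" "a \<in> VA"
  shows "interv_prob M Apot s a = identified_prob VZ VW VA (observed_law M Z S W A VZ VS VW VA) s a"
proof -
  have "to_nat_on VA a < card VA"
    using to_nat_on_finite[OF finite_values(5)] assms(3) by (auto simp: bij_betw_def)
  then have "interv_prob M Apot s a = prob_vec M (Apot s) VA $ to_nat_on VA a"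
    using assms(3) finite_values(5) by (simp add: prob_vec_def interv_prob_def countable_finite)
  then show ?thesis
    using potential_action_identified[OF assms(1,2)]
    by (simp add: identified_prob_def identified_probs_observed_law)
qed

lemma argmax_actions_identified:
  assumes "s \<in> rv_support M S" "rank_condition M Z S W VZ VW (card VU)"
  shows "argmax_actions M Apot VA s = {a. is_arg_max
      (identified_prob VZ VW VA (observed_law M Z S W A VZ VS VW VA) s) (\<lambda>a. a \<in> VA) a}"
  using interv_prob_identified[OF assms] by (auto simp: argmax_actions_def is_arg_max_def)

text \<open>\<open>VA\<close> is finite, and nonempty because a probability space is nonempty; so a
  maximum is attained and \<open>arg_max_on\<close> makes a genuine choice.\<close>

lemma pi_opt_in_argmax: "pi_opt M Apot VA s \<in> argmax_actions M Apot VA s"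
proof -
  have "VA \<noteq> {}" using measurable_space[OF rv_A] not_empty by auto
  then have "Max (interv_prob M Apot s ` VA) \<in> interv_prob M Apot s ` VA"
    using finite_values(5) by (intro Max_in) auto
  then obtain a where a: "a \<in> VA" "interv_prob M Apot s a = Max (interv_prob M Apot s ` VA)"
    by auto
  have "interv_prob M Apot s b \<le> interv_prob M Apot s a" if "b \<in> VA" for b
    unfolding a(2) using that finite_values(5) by (intro Max_ge) auto
  with a(1) have "\<exists>a. is_arg_max (interv_prob M Apot s) (\<lambda>a. a \<in> VA) a"
    by (auto simp: is_arg_max_linorder)
  then show ?thesis
    unfolding pi_opt_def argmax_actions_def arg_max_on_def arg_max_def by (auto intro: someI_ex)
qed

end

theorem theorem4p5:
  fixes T :: nat and M :: "'m measure"
    and S :: "nat \<Rightarrow> 'm \<Rightarrow> 's" and W :: "nat \<Rightarrow> 'm \<Rightarrow> 'w" and U :: "nat \<Rightarrow> 'm \<Rightarrow> 'u"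
    and A :: "nat \<Rightarrow> 'm \<Rightarrow> 'a" and Apot :: "nat \<Rightarrow> 's \<Rightarrow> 'm \<Rightarrow> 'a"
    and VS :: "nat \<Rightarrow> 's set" and VW :: "nat \<Rightarrow> 'w set" and VU :: "nat \<Rightarrow> 'u set"
    and VA :: "nat \<Rightarrow> 'a set" and k :: "nat \<Rightarrow> nat"
  assumes k: "\<forall>t\<in>{1..T}. k t = card (VU (t - 1))"
    and model: "\<forall>t\<in>{1..T}. proxy_model M (S (t - 1)) (S t) (W (t - 1)) (U (t - 1)) (A t) (Apot t)
          (VS (t - 1)) (VS t) (VW (t - 1)) (VU (t - 1)) (VA t)"
  shows
    "\<comment> \<open>the two forms of the rank condition are equivalent\<close>
     (\<forall>t\<in>{1..T}. \<forall>s\<in>rv_support M (S t).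
        mat_rank (cond_mat M (W (t - 1)) (VW (t - 1)) (S (t - 1)) (VS (t - 1)) (S t) s) = k t
        \<longleftrightarrow> (\<exists>\<phi>Z \<in> VS (t - 1) \<rightarrow> {1..k t}. \<exists>\<phi>W \<in> VW (t - 1) \<rightarrow> {1..k t}.
              invertible_mat (cond_mat M (\<phi>W \<circ> W (t - 1)) {1..k t} (\<phi>Z \<circ> S (t - 1)) {1..k t} (S t) s)))
     \<and>
     ((\<forall>t\<in>{1..T}. rank_condition M (S (t - 1)) (S t) (W (t - 1)) (VS (t - 1)) (VW (t - 1)) (k t)) \<longrightarrow>
      (\<forall>t\<in>{1..T}.
        \<comment> \<open>identification: one pair of functions of the observed law serves this model and every
            other model of the assumptions with the same observed value sets\<close>
        (\<exists>F G.
          (let law = observed_law M (S (t - 1)) (S t) (W (t - 1)) (A t)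
                       (VS (t - 1)) (VS t) (VW (t - 1)) (VA t)
           in \<forall>s\<in>rv_support M (S t).
                (\<forall>a\<in>VA t. interv_prob M (Apot t) s a = F law s a) \<and>
                argmax_actions M (Apot t) (VA t) s = G law s) \<and>
          (\<forall>(N :: 'n measure) Z' S' W' (U' :: 'n \<Rightarrow> 'v) A' Apot' VU'.
             proxy_model N Z' S' W' U' A' Apot' (VS (t - 1)) (VS t) (VW (t - 1)) VU' (VA t) \<and>
             rank_condition N Z' S' W' (VS (t - 1)) (VW (t - 1)) (card VU') \<longrightarrow>
             (let law = observed_law N Z' S' W' A' (VS (t - 1)) (VS t) (VW (t - 1)) (VA t)
              in \<forall>s\<in>rv_support N S'.
                   (\<forall>a\<in>VA t. interv_prob N Apot' s a = F law s a) \<and>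
                   argmax_actions N Apot' (VA t) s = G law s))) \<and>
        \<comment> \<open>the explicit formula\<close>
        (\<forall>s\<in>rv_support M (S t).
          \<forall>\<phi>Z \<in> VS (t - 1) \<rightarrow> {1..k t}. \<forall>\<phi>W \<in> VW (t - 1) \<rightarrow> {1..k t}.
            let Zc = \<phi>Z \<circ> S (t - 1); Wc = \<phi>W \<circ> W (t - 1); K = {1..k t};
                P = cond_mat M Wc K Zc K (S t) s
            in invertible_mat P \<longrightarrow>
               prob_vec M (Apot t s) (VA t) =
               (cond_mat M (A t) (VA t) Zc K (S t) s * the (mat_inverse P)) *\<^sub>v prob_vec M Wc K) \<and>
        \<comment> \<open>the target policy picks an element of the identified argmax set\<close>
        (\<forall>s\<in>rv_support M (S t). pi_opt M (Apot t) (VA t) s \<in> argmax_actions M (Apot t) (VA t) s)))"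
proof (intro conjI impI ballI, goal_cases)
  case (1 t s)
  interpret proxy_model M "S (t - 1)" "S t" "W (t - 1)" "U (t - 1)" "A t" "Apot t"
    "VS (t - 1)" "VS t" "VW (t - 1)" "VU (t - 1)" "VA t"
    using model 1 by blast
  show ?case using rank_iff_invertible_coarsening[OF 1(2), of "{1..k t}"] k 1(1) by simp
next
  case (2 t)
  interpret proxy_model M "S (t - 1)" "S t" "W (t - 1)" "U (t - 1)" "A t" "Apot t"
    "VS (t - 1)" "VS t" "VW (t - 1)" "VU (t - 1)" "VA t"
    using model 2 by blast
  have rank: "rank_condition M (S (t - 1)) (S t) (W (t - 1)) (VS (t - 1)) (VW (t - 1)) (card (VU (t - 1)))"
    using 2 k by auto
  \<comment> \<open>Both witnesses are built from the observed value sets alone, so they serve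
    \<open>N\<close> as well, even if its latent set \<open>VU'\<close> has another size.\<close>
  let ?F = "identified_prob (VS (t - 1)) (VW (t - 1)) (VA t)"
  let ?G = "\<lambda>law s. {a. is_arg_max (?F law s) (\<lambda>a. a \<in> VA t) a}"
  show ?case
    unfolding Let_def
  proof (rule exI[of _ ?F], rule exI[of _ ?G], intro conjI allI impI ballI)
    fix s assume s: "s \<in> rv_support M (S t)"
    let ?law = "observed_law M (S (t - 1)) (S t) (W (t - 1)) (A t) (VS (t - 1)) (VS t) (VW (t - 1)) (VA t)"
    show "interv_prob M (Apot t) s a = ?F ?law s a" if "a \<in> VA t" for a
      using interv_prob_identified[OF s rank that] .
    show "argmax_actions M (Apot t) (VA t) s = ?G ?law s"
      using argmax_actions_identified[OF s rank] .
  next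
    fix N :: "'n measure" and Z' S' W' A' Apot' VU' s and U' :: "'n \<Rightarrow> 'v"
    let ?law = "observed_law N Z' S' W' A' (VS (t - 1)) (VS t) (VW (t - 1)) (VA t)"
    assume N: "proxy_model N Z' S' W' U' A' Apot' (VS (t - 1)) (VS t) (VW (t - 1)) VU' (VA t) \<and>
        rank_condition N Z' S' W' (VS (t - 1)) (VW (t - 1)) (card VU')"
      and s: "s \<in> rv_support N S'"
    show "interv_prob N Apot' s a = ?F ?law s a" if "a \<in> VA t" for a
      using proxy_model.interv_prob_identified[OF conjunct1[OF N] s conjunct2[OF N] that] .
    show "argmax_actions N Apot' (VA t) s = ?G ?law s"
      using proxy_model.argmax_actions_identified[OF conjunct1[OF N] s conjunct2[OF N]] .
  qed
next
  case (3 t s \<phi>Z \<phi>W)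
  interpret proxy_model M "S (t - 1)" "S t" "W (t - 1)" "U (t - 1)" "A t" "Apot t"
    "VS (t - 1)" "VS t" "VW (t - 1)" "VU (t - 1)" "VA t"
    using model 3 by blast
  show ?case
    using potential_action_formula[OF 3(3), of "{1..k t}"] k 3(2)
    by (simp add: Let_def proxy_formula_def)
next
  case (4 t s)
  interpret proxy_model M "S (t - 1)" "S t" "W (t - 1)" "U (t - 1)" "A t" "Apot t"
    "VS (t - 1)" "VS t" "VW (t - 1)" "VU (t - 1)" "VA t"
    using model 4 by blast
  show ?case by (rule pi_opt_in_argmax)
qed

end
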